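(* Let $x_1,\dots,x_n$ be i.i.d. $\mathcal{N}(0,S)$ with $n\ge 2$, consider the linear model $f(x;w)=w^\top x$ ($w\in\mathbb{R}^d$) with arbitrary targets $y_1,\dots,y_n\in\mathbb{R}$. There exists an absolute constant $C>0$ such that for any $\epsilon,\delta\in(0,1)$, if $n/\log(n/\delta)\ge C/\epsilon^2$ and $d_{\mathrm{eff}}\ge C\log(n/\delta)/\epsilon^2$, then with probability at least $1-\delta$, for all targets and all $w\in\mathbb{R}^d$, $$\frac{(1-\epsilon)^2}{(1+\epsilon)^2}\le\mu(w)\le\frac{(1+\epsilon)^2}{(1-\epsilon)^2}.$$
   Context: $S\in\mathbb{R}^{d\times d}$ is symmetric positive semidefinite and nonzero; the stable rank of a PSD matrix $A\neq0$ is $\mathrm{srk}(A)=\mathrm{tr}(A)/\|A\|$ (spectral norm), and $d_{\mathrm{eff}}=\min\{\mathrm{srk}(S),\mathrm{srk}(S^2)\}$. With $\ell_i(w)=\frac12(w^\top x_i-y_i)^2$, $\mathcal{L}(w)=\frac1n\sum_i\ell_i(w)$, $G=\frac1n\sum_i x_ix_i^\top$, $\Sigma_1(w)=\frac1n\sum_i\nabla\ell_i(w)\nabla\ell_i(w)^\top$, define $\mu(w)=\frac{\mathrm{tr}(\Sigma_1(w)G)}{2\mathcal{L}(w)\|G\|_F^2}$, with $\mu(w)=1$ whenever the denominator vanishes. *)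

theory Defs
  imports "HOL-Probability.Probability"
begin

text \<open>Vectors in R^d are functions nat => real (only indices < d matter);
  d x d matrices are functions nat => nat => real (only indices < d matter).\<close>

definition mat_mul :: "nat \<Rightarrow> (nat \<Rightarrow> nat \<Rightarrow> real) \<Rightarrow> (nat \<Rightarrow> nat \<Rightarrow> real) \<Rightarrow> (nat \<Rightarrow> nat \<Rightarrow> real)" where
  "mat_mul d A B = (\<lambda>i j. \<Sum>k<d. A i k * B k j)"

definition mtrace :: "nat \<Rightarrow> (nat \<Rightarrow> nat \<Rightarrow> real) \<Rightarrow> real" where
  "mtrace d A = (\<Sum>i<d. A i i)"

definition spec_norm :: "nat \<Rightarrow> (nat \<Rightarrow> nat \<Rightarrow> real) \<Rightarrow> real" where
  "spec_norm d A = Sup {sqrt (\<Sum>i<d. (\<Sum>j<d. A i j * v j)\<^sup>2) | v. (\<Sum>j<d. (v j)\<^sup>2) = 1}"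

definition frob_sq :: "nat \<Rightarrow> (nat \<Rightarrow> nat \<Rightarrow> real) \<Rightarrow> real" where
  "frob_sq d A = (\<Sum>i<d. \<Sum>j<d. (A i j)\<^sup>2)"

definition sym_psd :: "nat \<Rightarrow> (nat \<Rightarrow> nat \<Rightarrow> real) \<Rightarrow> bool" where
  "sym_psd d S \<longleftrightarrow> (\<forall>i<d. \<forall>j<d. S i j = S j i) \<and>
     (\<forall>v. 0 \<le> (\<Sum>i<d. \<Sum>j<d. v i * S i j * v j))"

definition srk :: "nat \<Rightarrow> (nat \<Rightarrow> nat \<Rightarrow> real) \<Rightarrow> real" where
  "srk d A = mtrace d A / spec_norm d A"

definition d_eff :: "nat \<Rightarrow> (nat \<Rightarrow> nat \<Rightarrow> real) \<Rightarrow> real" where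
  "d_eff d S = min (srk d S) (srk d (mat_mul d S S))"

definition inner_d :: "nat \<Rightarrow> (nat \<Rightarrow> real) \<Rightarrow> (nat \<Rightarrow> real) \<Rightarrow> real" where
  "inner_d d u v = (\<Sum>j<d. u j * v j)"

definition loss_i :: "nat \<Rightarrow> (nat \<Rightarrow> nat \<Rightarrow> real) \<Rightarrow> (nat \<Rightarrow> real) \<Rightarrow> (nat \<Rightarrow> real) \<Rightarrow> nat \<Rightarrow> real" where
  "loss_i d x y w i = (inner_d d w (x i) - y i)\<^sup>2 / 2"

definition emp_loss :: "nat \<Rightarrow> nat \<Rightarrow> (nat \<Rightarrow> nat \<Rightarrow> real) \<Rightarrow> (nat \<Rightarrow> real) \<Rightarrow> (nat \<Rightarrow> real) \<Rightarrow> real" where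
  "emp_loss d n x y w = (\<Sum>i<n. loss_i d x y w i) / real n"

definition grad_i :: "nat \<Rightarrow> (nat \<Rightarrow> nat \<Rightarrow> real) \<Rightarrow> (nat \<Rightarrow> real) \<Rightarrow> (nat \<Rightarrow> real) \<Rightarrow> nat \<Rightarrow> (nat \<Rightarrow> real)" where
  "grad_i d x y w i = (\<lambda>j. (inner_d d w (x i) - y i) * x i j)"

definition gram :: "nat \<Rightarrow> (nat \<Rightarrow> nat \<Rightarrow> real) \<Rightarrow> (nat \<Rightarrow> nat \<Rightarrow> real)" where
  "gram n x = (\<lambda>j k. (\<Sum>i<n. x i j * x i k) / real n)"

definition grad_cov :: "nat \<Rightarrow> nat \<Rightarrow> (nat \<Rightarrow> nat \<Rightarrow> real) \<Rightarrow> (nat \<Rightarrow> real) \<Rightarrow> (nat \<Rightarrow> real) \<Rightarrow> (nat \<Rightarrow> nat \<Rightarrow> real)" where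
  "grad_cov d n x y w = (\<lambda>j k. (\<Sum>i<n. grad_i d x y w i j * grad_i d x y w i k) / real n)"

definition mu :: "nat \<Rightarrow> nat \<Rightarrow> (nat \<Rightarrow> nat \<Rightarrow> real) \<Rightarrow> (nat \<Rightarrow> real) \<Rightarrow> (nat \<Rightarrow> real) \<Rightarrow> real" where
  "mu d n x y w =
    (let den = 2 * emp_loss d n x y w * frob_sq d (gram n x) in
     if den = 0 then 1 else mtrace d (mat_mul d (grad_cov d n x y w) (gram n x)) / den)"

definition std_gauss_space :: "nat \<Rightarrow> nat \<Rightarrow> (nat \<times> nat \<Rightarrow> real) measure" where
  "std_gauss_space n d = PiM ({..<n} \<times> {..<d}) (\<lambda>_. density lborel std_normal_density)"

text \<open>Samples x_i = A z_i, which are i.i.d. N(0, A A^T).\<close>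
definition gauss_samples :: "nat \<Rightarrow> (nat \<Rightarrow> nat \<Rightarrow> real) \<Rightarrow> (nat \<times> nat \<Rightarrow> real) \<Rightarrow> (nat \<Rightarrow> nat \<Rightarrow> real)" where
  "gauss_samples d A z = (\<lambda>i j. \<Sum>k<d. A j k * z (i, k))"

end

theory Submission
  imports Defs
begin

text \<open>The ratio \<open>\<mu>(w)\<close> is a weighted mean of the numbers \<open>q\<^sub>i = \<Sum>\<^sub>l (x\<^sub>i\<^sup>T x\<^sub>l)\<^sup>2\<close>, with weights the squared
  residuals, divided by their plain mean; so it is enough that all \<open>q\<^sub>i\<close> lie within factors
  \<open>(1 \<plusminus> \<epsilon>)\<^sup>2\<close> of a common value. With \<open>x\<^sub>i = A z\<^sub>i\<close>, the diagonal term of \<open>q\<^sub>i\<close> is \<open>\<parallel>A z\<^sub>i\<parallel>\<^sup>4\<close> and,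
  conditionally on \<open>z\<^sub>i\<close>, the rest is \<open>x\<^sub>i\<^sup>T S x\<^sub>i\<close> times a chi-squared variable with \<open>n - 1\<close> degrees of
  freedom, where \<open>x\<^sub>i\<^sup>T S x\<^sub>i = \<parallel>A\<^sup>T A z\<^sub>i\<parallel>\<^sup>2\<close>. All three are squared norms \<open>\<parallel>W z\<parallel>\<^sup>2\<close> of Gaussian images, which
  deviate from their mean by a factor \<open>1 \<plusminus> \<epsilon>\<close> with probability exponentially small in \<open>\<epsilon>\<^sup>2\<close> times the
  stable rank of \<open>W\<^sup>T W\<close>. The moment generating function behind this is bounded without
  diagonalisation, by integrating out one coordinate at a time.\<close>

section \<open>Gaussian quadratic forms\<close>

abbreviation gauss :: "'i set \<Rightarrow> ('i \<Rightarrow> real) measure" where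
  "gauss J \<equiv> PiM J (\<lambda>_. std_normal_distribution)"

lemma prob_space_std_gauss: "prob_space (std_normal_distribution)"
  by (rule prob_space_normal_density) simp

lemma product_sigma_finite_gauss:
  "product_sigma_finite (\<lambda>_. std_normal_distribution)"
  by (intro product_sigma_finite.intro prob_space_imp_sigma_finite prob_space_std_gauss)

text \<open>Completing the square: after multiplication by the standard normal density, the
  integrand is a constant multiple of the normal density with mean \<open>s / (1 - b)\<close> and
  variance \<open>1 / (1 - b)\<close>.\<close>

lemma nn_integral_exp_quadratic:
  fixes b s :: real
  assumes "b < 1"
  shows "(\<integral>\<^sup>+t. ennreal (exp (b * t\<^sup>2 / 2 + s * t)) \<partial>std_normal_distribution)
    = ennreal (exp (s\<^sup>2 / (2 * (1 - b))) / sqrt (1 - b))"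
proof -
  define \<sigma> where "\<sigma> = 1 / sqrt (1 - b)"
  have \<sigma>: "\<sigma> > 0" "\<sigma>\<^sup>2 = 1 / (1 - b)"
    using assms by (auto simp: \<sigma>_def power_divide)
  have dens: "std_normal_density t * exp (b * t\<^sup>2 / 2 + s * t)
      = exp (s\<^sup>2 / (2 * (1 - b))) / sqrt (1 - b) * normal_density (s / (1 - b)) \<sigma> t" for t
  proof -
    have e: "- t\<^sup>2 / 2 + (b * t\<^sup>2 / 2 + s * t)
        = s\<^sup>2 / (2 * (1 - b)) + - (t - s / (1 - b))\<^sup>2 / (2 * \<sigma>\<^sup>2)"
    proof -
      define c where "c = 1 - b"
      then have b: "b = 1 - c" and "c > 0" using assms by auto
      then show ?thesis unfolding \<sigma> unfolding b by (simp add: field_simps power2_eq_square)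
    qed
    have q: "1 / sqrt (2 * pi * \<sigma>\<^sup>2) = sqrt (1 - b) / sqrt (2 * pi)"
      unfolding \<sigma> using assms by (simp add: real_sqrt_divide real_sqrt_mult)
    have "std_normal_density t * exp (b * t\<^sup>2 / 2 + s * t)
        = 1 / sqrt (2 * pi) * exp (- t\<^sup>2 / 2 + (b * t\<^sup>2 / 2 + s * t))"
      unfolding std_normal_density_def exp_add by simp
    also have "\<dots> = exp (s\<^sup>2 / (2 * (1 - b))) / sqrt (1 - b) * normal_density (s / (1 - b)) \<sigma> t"
      unfolding e normal_density_def q exp_add using assms by simp
    finally show ?thesis .
  qed
  have "(\<integral>\<^sup>+t. ennreal (exp (b * t\<^sup>2 / 2 + s * t)) \<partial>std_normal_distribution)
      = (\<integral>\<^sup>+t. ennreal (exp (s\<^sup>2 / (2 * (1 - b))) / sqrt (1 - b)) *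
           ennreal (normal_density (s / (1 - b)) \<sigma> t) \<partial>lborel)"
    by (subst nn_integral_density) (auto simp: dens assms less_imp_le simp flip: ennreal_mult)
  also have "\<dots> = ennreal (exp (s\<^sup>2 / (2 * (1 - b))) / sqrt (1 - b)) *
      (\<integral>\<^sup>+t. ennreal (normal_density (s / (1 - b)) \<sigma> t) \<partial>lborel)"
    by (rule nn_integral_cmult) simp
  also have "(\<integral>\<^sup>+t. ennreal (normal_density (s / (1 - b)) \<sigma> t) \<partial>lborel) = 1"
    using prob_space.emeasure_space_1[OF prob_space_normal_density[OF \<sigma>(1)]] by (simp add: emeasure_density)
  finally show ?thesis by simp
qed

text \<open>Turns the factor left by integrating out one coordinate into an exponential:
  \<open>b / 2\<close> feeds the trace term of the final exponent and \<open>b\<^sup>2\<close> the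
  Frobenius term. It follows from \<open>- ln (1 - b) \<le> b + 2 * b\<^sup>2\<close>.\<close>

lemma inverse_sqrt_le_exp:
  fixes b :: real
  assumes "\<bar>b\<bar> \<le> 1/4"
  shows "1 / sqrt (1 - b) \<le> exp (b / 2 + b\<^sup>2)"
proof -
  have "- ln (1 - b) \<le> b + 2 * b\<^sup>2"
    using ln_one_minus_pos_lower_bound[of b] ln_add_one_self_le_self2[of "-b"]
      ln_one_plus_pos_lower_bound[of "-b"] assms
    by (cases "b \<ge> 0") (auto simp: abs_if power2_eq_square)
  then have "exp (- ln (1 - b) / 2) \<le> exp (b / 2 + b\<^sup>2)"
    by simp
  also have "exp (- ln (1 - b) / 2) = 1 / sqrt (1 - b)"
    using assms by (simp add: ln_sqrt[symmetric] exp_minus inverse_eq_divide)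
  finally show ?thesis .
qed

text \<open>Displays the form as a quadratic polynomial in the coordinate \<open>t\<close> at
  \<open>a\<close>, the shape that \<open>nn_integral_exp_quadratic\<close> integrates.\<close>

lemma sum_insert_quadratic:
  fixes B :: "'i \<Rightarrow> 'i \<Rightarrow> real"
  assumes "finite J" "a \<notin> J" "\<And>k. k \<in> J \<Longrightarrow> B k a = B a k"
  shows "(\<Sum>k\<in>insert a J. \<Sum>l\<in>insert a J. B k l * (v(a := t)) k * (v(a := t)) l)
    = (\<Sum>k\<in>J. \<Sum>l\<in>J. B k l * v k * v l) + 2 * t * (\<Sum>l\<in>J. B a l * v l) + B a a * t\<^sup>2"
proof -
  have *: "k \<in> J \<Longrightarrow> k \<noteq> a" for k using assms(2) by auto
  have "(\<Sum>l\<in>J. B a l * t * v l) = t * (\<Sum>l\<in>J. B a l * v l)"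
    by (simp add: sum_distrib_left mult_ac)
  moreover have "(\<Sum>k\<in>J. B k a * v k * t) = t * (\<Sum>l\<in>J. B a l * v l)"
    by (simp add: sum_distrib_left assms(3) mult_ac)
  ultimately show ?thesis
    using assms(1,2) * by (simp add: sum.distrib power2_eq_square cong: sum.cong)
qed

text \<open>Integrating out coordinate \<open>a\<close> replaces \<open>I - B\<close> by its Schur complement, that is \<open>B\<close> by
  \<open>B' + b b\<^sup>T / (1 - B\<^sub>a\<^sub>a)\<close>, and this preserves the bound on the quadratic form.\<close>
lemma gauss_quadratic_form_mgf:
  fixes B :: "'i \<Rightarrow> 'i \<Rightarrow> real"
  assumes "finite J"
    and "\<And>k l. k \<in> J \<Longrightarrow> l \<in> J \<Longrightarrow> B k l = B l k"
    and "\<And>v. \<bar>\<Sum>k\<in>J. \<Sum>l\<in>J. B k l * v k * v l\<bar> \<le> (\<Sum>k\<in>J. (v k)\<^sup>2) / 4"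
  shows "(\<integral>\<^sup>+z. ennreal (exp ((\<Sum>k\<in>J. \<Sum>l\<in>J. B k l * z k * z l) / 2)) \<partial>gauss J)
    \<le> ennreal (exp ((\<Sum>k\<in>J. B k k) / 2 + (\<Sum>k\<in>J. \<Sum>l\<in>J. (B k l)\<^sup>2)))"
  using assms
proof (induction J arbitrary: B rule: finite_induct)
  case empty
  show ?case by (simp add: product_sigma_finite.nn_integral_empty[OF product_sigma_finite_gauss] PiM_empty emeasure_count_space)
next
  case (insert a J)
  define b where "b = B a a"
  define s where "s v = (\<Sum>l\<in>J. B a l * v l)" for v
  define q where "q v = (\<Sum>k\<in>J. \<Sum>l\<in>J. B k l * v k * v l)" for v
  define D where "D k l = B k l + B a k * B a l / (1 - b)" for k l
  define r where "r = (\<Sum>l\<in>J. (B a l)\<^sup>2)"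
  define w where "w = (\<Sum>k\<in>J. \<Sum>l\<in>J. B k l * B a k * B a l)"
  have sym: "k \<in> J \<Longrightarrow> B k a = B a k" for k
    using insert.prems(1) by auto
  have aJ: "k \<in> J \<Longrightarrow> k \<noteq> a" for k using insert.hyps by auto
  have full: "(\<Sum>k\<in>insert a J. \<Sum>l\<in>insert a J. B k l * (v(a := t)) k * (v(a := t)) l)
      = q v + 2 * t * s v + b * t\<^sup>2" for v t
    unfolding q_def s_def b_def using insert.hyps sym by (intro sum_insert_quadratic) auto
  have full_norm: "(\<Sum>k\<in>insert a J. ((v(a := t)) k)\<^sup>2) = (\<Sum>k\<in>J. (v k)\<^sup>2) + t\<^sup>2" for v :: "'i \<Rightarrow> real" and t
    using insert.hyps aJ by (simp cong: sum.cong)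
  have bd: "\<bar>q v + 2 * t * s v + b * t\<^sup>2\<bar> \<le> ((\<Sum>k\<in>J. (v k)\<^sup>2) + t\<^sup>2) / 4" for v t
    using insert.prems(2)[of "v(a := t)"] unfolding full full_norm .
  have b: "\<bar>b\<bar> \<le> 1/4"
    using bd[of "\<lambda>_. 0" 1] by (simp add: q_def s_def)
  have ss: "(s v)\<^sup>2 / (1 - b) = (\<Sum>k\<in>J. \<Sum>l\<in>J. B a k * B a l / (1 - b) * v k * v l)" for v
    unfolding s_def power2_eq_square sum_product sum_divide_distrib by (simp add: mult_ac)
  have qD: "(\<Sum>k\<in>J. \<Sum>l\<in>J. D k l * v k * v l) = q v + (s v)\<^sup>2 / (1 - b)" for v
    unfolding ss q_def D_def by (simp add: distrib_right sum.distrib)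
  have IH: "(\<integral>\<^sup>+z. ennreal (exp ((\<Sum>k\<in>J. \<Sum>l\<in>J. D k l * z k * z l) / 2)) \<partial>gauss J)
    \<le> ennreal (exp ((\<Sum>k\<in>J. D k k) / 2 + (\<Sum>k\<in>J. \<Sum>l\<in>J. (D k l)\<^sup>2)))"
  proof (rule insert.IH)
    show "D k l = D l k" if "k \<in> J" "l \<in> J" for k l
      using insert.prems(1)[of k l] that by (simp add: D_def)
    show "\<bar>\<Sum>k\<in>J. \<Sum>l\<in>J. D k l * v k * v l\<bar> \<le> (\<Sum>k\<in>J. (v k)\<^sup>2) / 4" for v
    proof -
      have pos: "0 \<le> (s v)\<^sup>2 / (1 - b)"
        using b by simp
      \<comment> \<open>\<open>x\<close> maximises
        \<open>q v + 2 * t * s v - (1 - b) * t\<^sup>2\<close> over \<open>t\<close>, and the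
        maximum is the form of \<open>D\<close>; so the hypothesis on \<open>B\<close>, tested at
        \<open>t = x\<close>, bounds the form of \<open>D\<close> from above.\<close>
      define x where "x = s v / (1 - b)"
      have sx: "s v = (1 - b) * x" using b by (simp add: x_def)
      have "(s v)\<^sup>2 / (1 - b) = (1 - b) * x\<^sup>2"
        unfolding sx using b by (simp add: power2_eq_square)
      then have e: "(s v)\<^sup>2 / (1 - b) = x\<^sup>2 - b * x\<^sup>2"
        by (simp add: left_diff_distrib)
      have "q v + ((2 - b) * x\<^sup>2) \<le> ((\<Sum>k\<in>J. (v k)\<^sup>2) + x\<^sup>2) / 4"
      proof -
        have "(2 - b) * x\<^sup>2 = 2 * x * s v + b * x\<^sup>2"
          unfolding sx by (simp add: algebra_simps power2_eq_square)
        then show ?thesis using bd[of v x] by linarith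
      qed
      moreover have "q v + (s v)\<^sup>2 / (1 - b) + 3/4 * x\<^sup>2 = q v + ((2 - b) * x\<^sup>2) - x\<^sup>2 / 4"
        unfolding e by (simp add: left_diff_distrib)
      moreover have "0 \<le> 3/4 * x\<^sup>2" by simp
      ultimately have "q v + (s v)\<^sup>2 / (1 - b) \<le> (\<Sum>k\<in>J. (v k)\<^sup>2) / 4"
        unfolding add_divide_distrib by linarith
      \<comment> \<open>For the lower bound, the rank-one correction is nonnegative, so the form of
        \<open>D\<close> is at least \<open>q v\<close>.\<close>
      moreover have "- ((\<Sum>k\<in>J. (v k)\<^sup>2) / 4) \<le> q v"
        using bd[of v 0] by simp
      ultimately show ?thesis
        unfolding qD using pos by linarith
    qed
  qed
  have trD: "(\<Sum>k\<in>J. D k k) = (\<Sum>k\<in>J. B k k) + r / (1 - b)"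
    by (simp add: D_def r_def sum.distrib sum_divide_distrib power2_eq_square)
  have FD: "(\<Sum>k\<in>J. \<Sum>l\<in>J. (D k l)\<^sup>2)
      = (\<Sum>k\<in>J. \<Sum>l\<in>J. (B k l)\<^sup>2) + 2 * w / (1 - b) + (r / (1 - b))\<^sup>2"
  proof -
    have "(D k l)\<^sup>2 = (B k l)\<^sup>2 + 2 * (B k l * B a k * B a l) / (1 - b)
        + (B a k)\<^sup>2 * (B a l)\<^sup>2 / (1 - b)\<^sup>2" for k l
      unfolding D_def by (simp add: power2_sum power_divide power_mult_distrib mult_ac)
    moreover have "(r / (1 - b))\<^sup>2 = (\<Sum>k\<in>J. \<Sum>l\<in>J. (B a k)\<^sup>2 * (B a l)\<^sup>2 / (1 - b)\<^sup>2)"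
      unfolding power_divide r_def power2_eq_square[of "sum _ _"] sum_product
      by (simp add: sum_divide_distrib)
    moreover have "2 * w / (1 - b) = (\<Sum>k\<in>J. \<Sum>l\<in>J. 2 * (B k l * B a k * B a l) / (1 - b))"
      by (simp add: w_def sum_divide_distrib sum_distrib_left)
    ultimately show ?thesis
      by (simp add: sum.distrib)
  qed
  have FB: "(\<Sum>k\<in>insert a J. \<Sum>l\<in>insert a J. (B k l)\<^sup>2)
      = (\<Sum>k\<in>J. \<Sum>l\<in>J. (B k l)\<^sup>2) + 2 * r + b\<^sup>2"
    using insert.hyps by (simp add: sum.distrib r_def b_def sym cong: sum.cong)
  have r0: "0 \<le> r" unfolding r_def by (intro sum_nonneg) simp
  have wr: "w \<le> r / 4"
    using bd[of "\<lambda>k. B a k" 0] by (simp add: q_def w_def r_def)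
  \<comment> \<open>Test vectors: the row of \<open>a\<close>, completed by 1/4 and by -1/4 at
    \<open>a\<close>. Combining the upper bound for one with the lower bound for the other cancels
    the terms in \<open>q\<close> and \<open>b\<close> and leaves
    \<open>r \<le> (r + 1/16) / 2\<close>.\<close>
  have r: "r \<le> 1/16"
  proof -
    have "s (\<lambda>l. B a l) = r" by (simp add: s_def r_def power2_eq_square)
    then show ?thesis
      using abs_le_D1[OF bd[of "\<lambda>k. B a k" "1/4"]] abs_le_D2[OF bd[of "\<lambda>k. B a k" "-(1/4)"]]
      unfolding r_def[symmetric] by (simp add: power2_eq_square)
  qed
  \<comment> \<open>The off-diagonal entries in row and column \<open>a\<close> add
    \<open>2 * r\<close> to the squared Frobenius norm. This pays for passing from \<open>B\<close>
    to \<open>D\<close> on \<open>J\<close>, which raises half the trace plus the squared Frobenius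
    norm by at most \<open>(2/3 + 2/3 + 1/9) * r\<close>.\<close>
  have ineq: "r / (1 - b) / 2 + (2 * w / (1 - b) + (r / (1 - b))\<^sup>2) \<le> 2 * r"
  proof -
    define X Y where "X = r / (1 - b)" and "Y = w / (1 - b)"
    have i: "1 / (1 - b) \<le> 4/3" "0 < 1 / (1 - b)" using b by (auto simp: field_simps)
    have "r * (1 / (1 - b)) \<le> r * (4/3)"
      using i r0 by (intro mult_left_mono) auto
    then have X: "X \<le> 4/3 * r" by (simp add: X_def)
    have "w * (1 / (1 - b)) \<le> r / 4 * (4/3)"
      using i wr r0 by (intro mult_mono) auto
    then have Y: "Y \<le> r / 3" by (simp add: Y_def)
    have "0 \<le> X" using r0 b by (simp add: X_def)
    then have "X\<^sup>2 \<le> (4/3 * r) * (4/3 * (1/16))"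
      unfolding power2_eq_square using X r r0 by (intro mult_mono) auto
    then have "X / 2 + (2 * Y + X\<^sup>2) \<le> 2 * r" using X Y r0 by simp
    then show ?thesis by (simp add: X_def Y_def)
  qed
  define g where "g = 1 / sqrt (1 - b)"
  have g0: "0 \<le> g" using b by (simp add: g_def)
  \<comment> \<open>Integrating over coordinate \<open>a\<close> alone leaves \<open>g\<close> times
    the integrand for \<open>D\<close>, to which the induction hypothesis applies.\<close>
  have inner: "(\<integral>\<^sup>+t. ennreal (exp ((\<Sum>k\<in>insert a J. \<Sum>l\<in>insert a J. B k l * (z(a := t)) k * (z(a := t)) l) / 2))
        \<partial>std_normal_distribution)
      = ennreal g * ennreal (exp ((\<Sum>k\<in>J. \<Sum>l\<in>J. D k l * z k * z l) / 2))" for z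
  proof -
    have "exp ((q z + 2 * t * s z + b * t\<^sup>2) / 2) = exp (q z / 2) * exp (b * t\<^sup>2 / 2 + s z * t)" for t
      by (simp add: exp_add[symmetric] field_simps)
    then have "(\<integral>\<^sup>+t. ennreal (exp ((q z + 2 * t * s z + b * t\<^sup>2) / 2)) \<partial>std_normal_distribution)
        = ennreal (exp (q z / 2)) * (\<integral>\<^sup>+t. ennreal (exp (b * t\<^sup>2 / 2 + s z * t)) \<partial>std_normal_distribution)"
      by (simp add: ennreal_mult nn_integral_cmult)
    also have "\<dots> = ennreal (exp (q z / 2) * (exp ((s z)\<^sup>2 / (2 * (1 - b))) / sqrt (1 - b)))"
      using b nn_integral_exp_quadratic[of b "s z"] by (simp add: ennreal_mult'[symmetric])
    also have "exp (q z / 2) * (exp ((s z)\<^sup>2 / (2 * (1 - b))) / sqrt (1 - b))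
        = g * exp ((q z + (s z)\<^sup>2 / (1 - b)) / 2)"
      by (simp add: g_def add_divide_distrib exp_add mult.commute)
    finally show ?thesis
      unfolding full qD using g0 by (simp add: ennreal_mult)
  qed
  have "(\<integral>\<^sup>+z. ennreal (exp ((\<Sum>k\<in>insert a J. \<Sum>l\<in>insert a J. B k l * z k * z l) / 2)) \<partial>gauss (insert a J))
      = (\<integral>\<^sup>+z. ennreal g * ennreal (exp ((\<Sum>k\<in>J. \<Sum>l\<in>J. D k l * z k * z l) / 2)) \<partial>gauss J)"
    unfolding inner[symmetric]
    using insert.hyps by (intro product_sigma_finite.product_nn_integral_insert[OF product_sigma_finite_gauss]) measurable
  also have "\<dots> = ennreal g * (\<integral>\<^sup>+z. ennreal (exp ((\<Sum>k\<in>J. \<Sum>l\<in>J. D k l * z k * z l) / 2)) \<partial>gauss J)"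
    by (rule nn_integral_cmult) measurable
  also have "\<dots> \<le> ennreal (exp (b / 2 + b\<^sup>2)) *
      ennreal (exp ((\<Sum>k\<in>J. D k k) / 2 + (\<Sum>k\<in>J. \<Sum>l\<in>J. (D k l)\<^sup>2)))"
    unfolding g_def using b by (intro mult_mono ennreal_leI inverse_sqrt_le_exp IH) auto
  also have "\<dots> = ennreal (exp (b / 2 + b\<^sup>2 + ((\<Sum>k\<in>J. D k k) / 2 + (\<Sum>k\<in>J. \<Sum>l\<in>J. (D k l)\<^sup>2))))"
    by (simp add: exp_add ennreal_mult)
  also have "\<dots> \<le> ennreal (exp ((\<Sum>k\<in>insert a J. B k k) / 2 + (\<Sum>k\<in>insert a J. \<Sum>l\<in>insert a J. (B k l)\<^sup>2)))"
    unfolding trD FD FB using insert.hyps ineq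
    by (intro ennreal_leI) (simp add: b_def[symmetric] add_divide_distrib)
  finally show ?case .
qed

section \<open>Tail bounds for squared norms of Gaussian images\<close>

lemma sum_bilinear_square:
  fixes W :: "'p \<Rightarrow> 'i \<Rightarrow> real"
  shows "(\<Sum>p\<in>P. (\<Sum>k\<in>J. W p k * v k)\<^sup>2)
    = (\<Sum>k\<in>J. \<Sum>l\<in>J. (\<Sum>p\<in>P. W p k * W p l) * v k * v l)"
proof -
  have "(\<Sum>p\<in>P. (\<Sum>k\<in>J. W p k * v k)\<^sup>2)
      = (\<Sum>p\<in>P. \<Sum>k\<in>J. \<Sum>l\<in>J. W p k * W p l * v k * v l)"
    by (simp add: power2_eq_square sum_product mult_ac)
  also have "\<dots> = (\<Sum>k\<in>J. \<Sum>p\<in>P. \<Sum>l\<in>J. W p k * W p l * v k * v l)"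
    by (rule sum.swap)
  also have "\<dots> = (\<Sum>k\<in>J. \<Sum>l\<in>J. \<Sum>p\<in>P. W p k * W p l * v k * v l)"
    by (intro sum.cong refl sum.swap)
  finally show ?thesis by (simp add: sum_distrib_right)
qed

text \<open>With \<open>y = W^T u\<close>, Cauchy-Schwarz gives
  \<open>|y|^4 \<le> |u|^2 * |W y|^2 \<le> \<beta> * |u|^2 * |y|^2\<close>, and one factor
  \<open>|y|^2\<close> cancels.\<close>

lemma transpose_norm_bound:
  fixes W :: "'p \<Rightarrow> 'i \<Rightarrow> real"
  assumes "0 \<le> \<beta>"
    and W: "\<And>v. (\<Sum>p\<in>P. (\<Sum>k\<in>J. W p k * v k)\<^sup>2) \<le> \<beta> * (\<Sum>k\<in>J. (v k)\<^sup>2)"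
  shows "(\<Sum>k\<in>J. (\<Sum>p\<in>P. W p k * u p)\<^sup>2) \<le> \<beta> * (\<Sum>p\<in>P. (u p)\<^sup>2)"
proof -
  define y where "y k = (\<Sum>p\<in>P. W p k * u p)" for k
  define N where "N = (\<Sum>k\<in>J. (y k)\<^sup>2)"
  define U where "U = (\<Sum>p\<in>P. (u p)\<^sup>2)"
  have U0: "0 \<le> U" unfolding U_def by (intro sum_nonneg) simp
  have N0: "0 \<le> N" unfolding N_def by (intro sum_nonneg) simp
  have "N = (\<Sum>k\<in>J. \<Sum>p\<in>P. u p * (W p k * y k))"
    unfolding N_def power2_eq_square by (subst (2) y_def) (simp add: sum_distrib_left mult_ac)
  also have "\<dots> = (\<Sum>p\<in>P. \<Sum>k\<in>J. u p * (W p k * y k))" by (rule sum.swap)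
  also have "\<dots> = (\<Sum>p\<in>P. u p * (\<Sum>k\<in>J. W p k * y k))"
    by (simp add: sum_distrib_left)
  finally have "N\<^sup>2 \<le> U * (\<Sum>p\<in>P. (\<Sum>k\<in>J. W p k * y k)\<^sup>2)"
    unfolding U_def by (simp add: Cauchy_Schwarz_ineq_sum)
  also have "\<dots> \<le> U * (\<beta> * N)"
    unfolding N_def by (intro mult_left_mono W U0)
  finally have le: "N * N \<le> (\<beta> * U) * N" by (simp add: power2_eq_square mult_ac)
  have "N \<le> \<beta> * U"
    using le N0 U0 assms(1) by (cases "N = 0") auto
  then show ?thesis unfolding N_def U_def y_def .
qed

text \<open>Column \<open>l\<close> of \<open>W^T W\<close> is \<open>W^T\<close> applied to column
  \<open>l\<close> of \<open>W\<close>, so the transposed bound applies column by column. This makes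
  the Frobenius term of the exponent proportional to the mean \<open>T\<close>.\<close>

lemma frobenius_gram_le:
  fixes W :: "'p \<Rightarrow> 'i \<Rightarrow> real"
  assumes "finite J" "0 \<le> \<beta>"
    and W: "\<And>v. (\<Sum>p\<in>P. (\<Sum>k\<in>J. W p k * v k)\<^sup>2) \<le> \<beta> * (\<Sum>k\<in>J. (v k)\<^sup>2)"
  shows "(\<Sum>k\<in>J. \<Sum>l\<in>J. (\<Sum>p\<in>P. W p k * W p l)\<^sup>2) \<le> \<beta> * (\<Sum>p\<in>P. \<Sum>k\<in>J. (W p k)\<^sup>2)"
proof -
  have "(\<Sum>k\<in>J. \<Sum>l\<in>J. (\<Sum>p\<in>P. W p k * W p l)\<^sup>2)
      = (\<Sum>l\<in>J. \<Sum>k\<in>J. (\<Sum>p\<in>P. W p k * W p l)\<^sup>2)"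
    by (rule sum.swap)
  also have "\<dots> \<le> (\<Sum>l\<in>J. \<beta> * (\<Sum>p\<in>P. (W p l)\<^sup>2))"
    by (rule sum_mono) (rule transpose_norm_bound[OF assms(2) W])
  also have "\<dots> = \<beta> * (\<Sum>p\<in>P. \<Sum>k\<in>J. (W p k)\<^sup>2)"
    unfolding sum_distrib_left[symmetric] by (subst sum.swap) (rule refl)
  finally show ?thesis .
qed

text \<open>Chernoff bound with parameter \<open>\<epsilon> / (4 \<beta>)\<close>, for both tails at once via the sign \<open>\<sigma>\<close>.\<close>
lemma gauss_image_norm_one_sided_tail:
  fixes W :: "'p \<Rightarrow> 'i \<Rightarrow> real"
  assumes "finite J" "0 < \<beta>" "0 < \<epsilon>" "\<epsilon> < 1" and \<sigma>: "\<bar>\<sigma>\<bar> = 1"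
    and W: "\<And>v. (\<Sum>p\<in>P. (\<Sum>k\<in>J. W p k * v k)\<^sup>2) \<le> \<beta> * (\<Sum>k\<in>J. (v k)\<^sup>2)"
  defines "T \<equiv> \<Sum>p\<in>P. \<Sum>k\<in>J. (W p k)\<^sup>2"
  shows "emeasure (gauss J) {z \<in> space (gauss J). \<epsilon> * T < \<sigma> * ((\<Sum>p\<in>P. (\<Sum>k\<in>J. W p k * z k)\<^sup>2) - T)}
    \<le> ennreal (exp (- (\<epsilon>\<^sup>2 * T / (16 * \<beta>))))"
proof -
  \<comment> \<open>This value minimises the exponent \<open>- (\<theta> * \<epsilon> * T / 2) +
    \<theta>\<^sup>2 * (\<beta> * T)\<close> reached at the end; \<open>\<epsilon> < 1\<close> keeps
    \<open>\<theta> * \<beta>\<close> below the 1/4 required by the generating function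
    bound.\<close>
  define \<theta> where "\<theta> = \<epsilon> / (4 * \<beta>)"
  have \<theta>: "0 < \<theta>" "\<theta> * \<beta> \<le> 1/4" using assms by (auto simp: \<theta>_def)
  define Q where "Q z = (\<Sum>p\<in>P. (\<Sum>k\<in>J. W p k * z k)\<^sup>2)" for z
  define M where "M k l = (\<Sum>p\<in>P. W p k * W p l)" for k l
  define B where "B k l = \<theta> * \<sigma> * M k l" for k l
  have \<sigma>2: "\<sigma>\<^sup>2 = 1" using \<sigma> by (metis one_power2 power2_abs)
  have Q: "Q z = (\<Sum>k\<in>J. \<Sum>l\<in>J. M k l * z k * z l)" for z
    unfolding Q_def M_def by (rule sum_bilinear_square)
  have BQ: "(\<Sum>k\<in>J. \<Sum>l\<in>J. B k l * z k * z l) = \<theta> * \<sigma> * Q z" for z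
    unfolding Q B_def by (simp add: sum_distrib_left mult_ac)
  have T: "(\<Sum>k\<in>J. M k k) = T"
    unfolding M_def T_def by (simp add: power2_eq_square sum.swap[of _ P J])
  have F: "(\<Sum>k\<in>J. \<Sum>l\<in>J. (M k l)\<^sup>2) \<le> \<beta> * T"
    unfolding M_def T_def using assms by (intro frobenius_gram_le) auto
  have mgf: "(\<integral>\<^sup>+z. ennreal (exp ((\<Sum>k\<in>J. \<Sum>l\<in>J. B k l * z k * z l) / 2)) \<partial>gauss J)
    \<le> ennreal (exp ((\<Sum>k\<in>J. B k k) / 2 + (\<Sum>k\<in>J. \<Sum>l\<in>J. (B k l)\<^sup>2)))"
  proof (rule gauss_quadratic_form_mgf)
    show "finite J" by fact
    show "B k l = B l k" for k l by (simp add: B_def M_def mult.commute)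
    show "\<bar>\<Sum>k\<in>J. \<Sum>l\<in>J. B k l * v k * v l\<bar> \<le> (\<Sum>k\<in>J. (v k)\<^sup>2) / 4" for v
    proof -
      have "0 \<le> Q v" unfolding Q_def by (intro sum_nonneg) simp
      then have "\<bar>\<theta> * \<sigma> * Q v\<bar> = \<theta> * Q v"
        using \<theta> \<sigma> by (simp add: abs_mult)
      also have "\<dots> \<le> \<theta> * (\<beta> * (\<Sum>k\<in>J. (v k)\<^sup>2))"
        using \<theta> W unfolding Q_def by (intro mult_left_mono) auto
      also have "\<dots> = (\<theta> * \<beta>) * (\<Sum>k\<in>J. (v k)\<^sup>2)" by simp
      also have "\<dots> \<le> 1/4 * (\<Sum>k\<in>J. (v k)\<^sup>2)"
        by (intro mult_right_mono \<theta> sum_nonneg) simp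
      finally show ?thesis unfolding BQ by simp
    qed
  qed
  have "emeasure (gauss J) {z \<in> space (gauss J). \<epsilon> * T < \<sigma> * (Q z - T)}
      = (\<integral>\<^sup>+z. indicator {z \<in> space (gauss J). \<epsilon> * T < \<sigma> * (Q z - T)} z \<partial>gauss J)"
    unfolding Q_def by (rule nn_integral_indicator[symmetric]) measurable
  also have "\<dots> \<le> (\<integral>\<^sup>+z. ennreal (exp (- (\<theta> * (\<sigma> + \<epsilon>) * T / 2))) * ennreal (exp (\<theta> * \<sigma> * Q z / 2)) \<partial>gauss J)"
  proof (intro nn_integral_mono)
    fix z
    \<comment> \<open>Markov's inequality: the exponent is \<open>\<theta> / 2\<close> times the
      excess \<open>\<sigma> * (Q z - T) - \<epsilon> * T\<close>, so on the event the exponential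
      dominates the indicator.\<close>
    have "1 \<le> exp (- (\<theta> * (\<sigma> + \<epsilon>) * T / 2) + \<theta> * \<sigma> * Q z / 2)" if "\<epsilon> * T < \<sigma> * (Q z - T)"
    proof -
      have "0 \<le> \<theta> * (\<sigma> * (Q z - T) - \<epsilon> * T) / 2" using that \<theta> by simp
      then show ?thesis by (simp add: algebra_simps add_divide_distrib diff_divide_distrib)
    qed
    then show "indicator {z \<in> space (gauss J). \<epsilon> * T < \<sigma> * (Q z - T)} z
        \<le> ennreal (exp (- (\<theta> * (\<sigma> + \<epsilon>) * T / 2))) * ennreal (exp (\<theta> * \<sigma> * Q z / 2))"
      unfolding ennreal_mult[OF exp_ge_zero exp_ge_zero, symmetric] exp_add[symmetric]
      by (simp add: indicator_def)
  qed
  also have "\<dots> = ennreal (exp (- (\<theta> * (\<sigma> + \<epsilon>) * T / 2))) *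
      (\<integral>\<^sup>+z. ennreal (exp (\<theta> * \<sigma> * Q z / 2)) \<partial>gauss J)"
    unfolding Q_def by (rule nn_integral_cmult) measurable
  also have "\<dots> \<le> ennreal (exp (- (\<theta> * (\<sigma> + \<epsilon>) * T / 2))) *
      ennreal (exp ((\<Sum>k\<in>J. B k k) / 2 + (\<Sum>k\<in>J. \<Sum>l\<in>J. (B k l)\<^sup>2)))"
    using mgf unfolding BQ by (intro mult_left_mono) auto
  also have "(\<Sum>k\<in>J. B k k) = \<theta> * \<sigma> * T"
    unfolding B_def T[symmetric] by (simp add: sum_distrib_left)
  also have "(\<Sum>k\<in>J. \<Sum>l\<in>J. (B k l)\<^sup>2) = \<theta>\<^sup>2 * (\<Sum>k\<in>J. \<Sum>l\<in>J. (M k l)\<^sup>2)"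
    unfolding B_def by (simp add: power_mult_distrib \<sigma>2 sum_distrib_left)
  \<comment> \<open>The contribution \<open>\<theta> * \<sigma> * T / 2\<close> of the mean cancels
    for either sign.\<close>
  also have "ennreal (exp (- (\<theta> * (\<sigma> + \<epsilon>) * T / 2))) *
      ennreal (exp (\<theta> * \<sigma> * T / 2 + \<theta>\<^sup>2 * (\<Sum>k\<in>J. \<Sum>l\<in>J. (M k l)\<^sup>2)))
    = ennreal (exp (- (\<theta> * \<epsilon> * T / 2) + \<theta>\<^sup>2 * (\<Sum>k\<in>J. \<Sum>l\<in>J. (M k l)\<^sup>2)))"
    by (simp add: ennreal_mult[symmetric] exp_add[symmetric] algebra_simps add_divide_distrib)
  also have "\<dots> \<le> ennreal (exp (- (\<theta> * \<epsilon> * T / 2) + \<theta>\<^sup>2 * (\<beta> * T)))"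
    using F by (intro ennreal_leI) (simp add: mult_left_mono)
  also have "- (\<theta> * \<epsilon> * T / 2) + \<theta>\<^sup>2 * (\<beta> * T) = - (\<epsilon>\<^sup>2 * T / (16 * \<beta>))"
    using assms(2) by (simp add: \<theta>_def power2_eq_square divide_simps)
  finally show ?thesis unfolding Q_def .
qed

lemma prob_space_gauss: "prob_space (gauss J)"
  by (intro prob_space_PiM prob_space_std_gauss)

text \<open>The union of the cases \<open>\<sigma> = 1\<close> and \<open>\<sigma> = -1\<close> of
  the one-sided bound, hence the factor 2.\<close>

lemma gauss_image_norm_tail:
  fixes W :: "'p \<Rightarrow> 'i \<Rightarrow> real"
  assumes "finite J" "0 < \<beta>" "0 < \<epsilon>" "\<epsilon> < 1"
    and W: "\<And>v. (\<Sum>p\<in>P. (\<Sum>k\<in>J. W p k * v k)\<^sup>2) \<le> \<beta> * (\<Sum>k\<in>J. (v k)\<^sup>2)"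
  defines "T \<equiv> \<Sum>p\<in>P. \<Sum>k\<in>J. (W p k)\<^sup>2"
  shows "emeasure (gauss J) {z \<in> space (gauss J). \<epsilon> * T < \<bar>(\<Sum>p\<in>P. (\<Sum>k\<in>J. W p k * z k)\<^sup>2) - T\<bar>}
    \<le> ennreal (2 * exp (- (\<epsilon>\<^sup>2 * T / (16 * \<beta>))))"
proof -
  define A where "A \<sigma> = {z \<in> space (gauss J). \<epsilon> * T < \<sigma> * ((\<Sum>p\<in>P. (\<Sum>k\<in>J. W p k * z k)\<^sup>2) - T)}" for \<sigma>
  have [measurable]: "A \<sigma> \<in> sets (gauss J)" for \<sigma> unfolding A_def by measurable
  have tail: "emeasure (gauss J) (A \<sigma>) \<le> ennreal (exp (- (\<epsilon>\<^sup>2 * T / (16 * \<beta>))))" if "\<bar>\<sigma>\<bar> = 1" for \<sigma>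
    unfolding A_def T_def using assms that by (intro gauss_image_norm_one_sided_tail) auto
  have "{z \<in> space (gauss J). \<epsilon> * T < \<bar>(\<Sum>p\<in>P. (\<Sum>k\<in>J. W p k * z k)\<^sup>2) - T\<bar>} = A 1 \<union> A (-1)"
    unfolding A_def by (auto simp: abs_if split: if_splits)
  then have "emeasure (gauss J) {z \<in> space (gauss J). \<epsilon> * T < \<bar>(\<Sum>p\<in>P. (\<Sum>k\<in>J. W p k * z k)\<^sup>2) - T\<bar>}
      \<le> emeasure (gauss J) (A 1) + emeasure (gauss J) (A (-1))"
    by (simp add: emeasure_subadditive)
  also have "\<dots> \<le> ennreal (exp (- (\<epsilon>\<^sup>2 * T / (16 * \<beta>)))) + ennreal (exp (- (\<epsilon>\<^sup>2 * T / (16 * \<beta>))))"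
    by (intro add_mono tail) auto
  also have "\<dots> = ennreal (2 * exp (- (\<epsilon>\<^sup>2 * T / (16 * \<beta>))))"
    by (simp add: ennreal_plus[symmetric] del: ennreal_plus)
  finally show ?thesis .
qed

section \<open>Sums over Gram matrices\<close>

text \<open>\<open>X^T X\<close> and \<open>X X^T\<close> have the same Frobenius norm: both expand
  to one fourfold sum, read in different orders. This is the passage from coordinates to inner
  products of samples.\<close>

lemma sum_gram_squares_swap:
  fixes X :: "'p \<Rightarrow> 'i \<Rightarrow> real"
  shows "(\<Sum>k\<in>J. \<Sum>l\<in>J. (\<Sum>p\<in>P. X p k * X p l)\<^sup>2) = (\<Sum>p\<in>P. \<Sum>q\<in>P. (\<Sum>k\<in>J. X p k * X q k)\<^sup>2)"
proof -
  define t where "t k l p q = X p k * X p l * (X q k * X q l)" for k l p q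
  have "(\<Sum>k\<in>J. \<Sum>l\<in>J. (\<Sum>p\<in>P. X p k * X p l)\<^sup>2) = (\<Sum>k\<in>J. \<Sum>l\<in>J. \<Sum>p\<in>P. \<Sum>q\<in>P. t k l p q)"
    by (simp add: power2_eq_square sum_product t_def)
  also have "\<dots> = (\<Sum>k\<in>J. \<Sum>p\<in>P. \<Sum>l\<in>J. \<Sum>q\<in>P. t k l p q)"
    by (rule sum.cong[OF refl], rule sum.swap)
  also have "\<dots> = (\<Sum>p\<in>P. \<Sum>k\<in>J. \<Sum>l\<in>J. \<Sum>q\<in>P. t k l p q)"
    by (rule sum.swap)
  also have "\<dots> = (\<Sum>p\<in>P. \<Sum>k\<in>J. \<Sum>q\<in>P. \<Sum>l\<in>J. t k l p q)"
    by (rule sum.cong[OF refl], rule sum.cong[OF refl], rule sum.swap)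
  also have "\<dots> = (\<Sum>p\<in>P. \<Sum>q\<in>P. \<Sum>k\<in>J. \<Sum>l\<in>J. t k l p q)"
    by (rule sum.cong[OF refl], rule sum.swap)
  also have "\<dots> = (\<Sum>p\<in>P. \<Sum>q\<in>P. (\<Sum>k\<in>J. X p k * X q k)\<^sup>2)"
    by (simp add: power2_eq_square sum_product t_def mult_ac)
  finally show ?thesis .
qed

lemma frobenius_mean_gram:
  fixes x :: "'i \<Rightarrow> 'j \<Rightarrow> real"
  shows "(\<Sum>j\<in>J. \<Sum>k\<in>J. ((\<Sum>i\<in>I. x i j * x i k) / c)\<^sup>2)
    = (\<Sum>i\<in>I. \<Sum>l\<in>I. (\<Sum>j\<in>J. x i j * x l j)\<^sup>2) / c\<^sup>2"
  unfolding power_divide sum_divide_distrib[symmetric] by (subst sum_gram_squares_swap) (rule refl)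

text \<open>The numerator of \<open>mu\<close>, with \<open>r\<close> the residuals and
  \<open>c\<close> the sample size. Once the sums over samples are moved outside, the two sums over
  coordinates form the square of one inner product.\<close>

lemma trace_weighted_gram_product:
  fixes x :: "'i \<Rightarrow> 'j \<Rightarrow> real"
  shows "(\<Sum>j\<in>J. \<Sum>k\<in>J. ((\<Sum>i\<in>I. (r i * x i j) * (r i * x i k)) / c) * ((\<Sum>l\<in>I. x l k * x l j) / c))
    = (\<Sum>i\<in>I. (r i)\<^sup>2 * (\<Sum>l\<in>I. (\<Sum>j\<in>J. x i j * x l j)\<^sup>2)) / c\<^sup>2"
proof -
  define t where "t j k i l = (r i)\<^sup>2 * ((x i j * x l j) * (x i k * x l k))" for j k i l
  have entry: "((\<Sum>i\<in>I. (r i * x i j) * (r i * x i k)) / c) * ((\<Sum>l\<in>I. x l k * x l j) / c)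
      = (\<Sum>i\<in>I. \<Sum>l\<in>I. t j k i l) / c\<^sup>2" for j k
  proof -
    have "(\<Sum>i\<in>I. (r i * x i j) * (r i * x i k)) * (\<Sum>l\<in>I. x l k * x l j) = (\<Sum>i\<in>I. \<Sum>l\<in>I. t j k i l)"
      unfolding sum_product t_def by (intro sum.cong refl) (simp add: power2_eq_square)
    then show ?thesis by (simp only: times_divide_times_eq power2_eq_square)
  qed
  have square: "(\<Sum>j\<in>J. \<Sum>k\<in>J. t j k i l) = (r i)\<^sup>2 * (\<Sum>j\<in>J. x i j * x l j)\<^sup>2" for i l
  proof -
    have "(\<Sum>j\<in>J. x i j * x l j)\<^sup>2 = (\<Sum>j\<in>J. \<Sum>k\<in>J. (x i j * x l j) * (x i k * x l k))"
      by (simp only: power2_eq_square sum_product)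
    then show ?thesis by (simp only: t_def sum_distrib_left)
  qed
  have "(\<Sum>j\<in>J. \<Sum>k\<in>J. \<Sum>i\<in>I. \<Sum>l\<in>I. t j k i l) = (\<Sum>j\<in>J. \<Sum>i\<in>I. \<Sum>k\<in>J. \<Sum>l\<in>I. t j k i l)"
    by (rule sum.cong[OF refl], rule sum.swap)
  also have "\<dots> = (\<Sum>i\<in>I. \<Sum>j\<in>J. \<Sum>k\<in>J. \<Sum>l\<in>I. t j k i l)"
    by (rule sum.swap)
  also have "\<dots> = (\<Sum>i\<in>I. \<Sum>j\<in>J. \<Sum>l\<in>I. \<Sum>k\<in>J. t j k i l)"
    by (rule sum.cong[OF refl], rule sum.cong[OF refl], rule sum.swap)
  also have "\<dots> = (\<Sum>i\<in>I. \<Sum>l\<in>I. \<Sum>j\<in>J. \<Sum>k\<in>J. t j k i l)"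
    by (rule sum.cong[OF refl], rule sum.swap)
  finally show ?thesis
    unfolding entry sum_divide_distrib[symmetric] by (simp only: square sum_distrib_left)
qed

text \<open>The weighted and the plain mean of \<open>q\<close> both lie in
  \<open>[a * K, b * K]\<close>, and \<open>K\<close> cancels in their quotient.\<close>

lemma weighted_mean_over_mean_bounds:
  fixes r q :: "nat \<Rightarrow> real" and n :: nat
  assumes "0 < a" "a \<le> b" "0 < K" and r0: "\<And>i. 0 \<le> r i"
    and q: "\<And>i. i < n \<Longrightarrow> a * K \<le> q i" "\<And>i. i < n \<Longrightarrow> q i \<le> b * K"
    and nz: "(\<Sum>i<n. r i) \<noteq> 0"
  shows "a / b \<le> n * (\<Sum>i<n. r i * q i) / ((\<Sum>i<n. r i) * (\<Sum>i<n. q i))"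
    and "n * (\<Sum>i<n. r i * q i) / ((\<Sum>i<n. r i) * (\<Sum>i<n. q i)) \<le> b / a"
proof -
  define R where "R = (\<Sum>i<n. r i)"
  define Q where "Q = (\<Sum>i<n. q i)"
  define N where "N = (\<Sum>i<n. r i * q i)"
  have n: "real n > 0" using nz by (cases n) auto
  have "0 \<le> R" unfolding R_def by (intro sum_nonneg r0)
  then have R: "0 < R" using nz by (simp add: R_def)
  have "(\<Sum>i<n. a * K) \<le> Q" "Q \<le> (\<Sum>i<n. b * K)"
    unfolding Q_def by (intro sum_mono q; simp)+
  then have Q1: "n * (a * K) \<le> Q" and Q2: "Q \<le> n * (b * K)" by auto
  have "0 < n * (a * K)" using n assms by simp
  then have Q0: "0 < Q" using Q1 by linarith
  have "(\<Sum>i<n. r i * (a * K)) \<le> N" "N \<le> (\<Sum>i<n. r i * (b * K))"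
    unfolding N_def by (intro sum_mono mult_left_mono q r0; simp)+
  then have N1: "R * (a * K) \<le> N" and N2: "N \<le> R * (b * K)"
    by (auto simp: R_def sum_distrib_right)
  have b: "0 < b" using assms by linarith
  have "a * (R * Q) \<le> a * (R * (n * (b * K)))"
    using Q2 R assms(1) by (intro mult_left_mono) auto
  also have "\<dots> = n * b * (R * (a * K))" by simp
  also have "\<dots> \<le> n * b * N" using N1 n b by (intro mult_left_mono) auto
  finally have "a / b \<le> n * N / (R * Q)"
    using R Q0 b by (simp add: divide_simps mult_ac)
  then show "a / b \<le> n * (\<Sum>i<n. r i * q i) / ((\<Sum>i<n. r i) * (\<Sum>i<n. q i))"
    unfolding N_def R_def Q_def .
  have "a * (n * N) \<le> a * (n * (R * (b * K)))"
    using N2 n assms(1) by (intro mult_left_mono) auto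
  also have "\<dots> = b * R * (n * (a * K))" by simp
  also have "\<dots> \<le> b * R * Q" using Q1 R b by (intro mult_left_mono) auto
  finally have "n * N / (R * Q) \<le> b / a"
    using R Q0 assms(1) by (simp add: divide_simps mult_ac)
  then show "n * (\<Sum>i<n. r i * q i) / ((\<Sum>i<n. r i) * (\<Sum>i<n. q i)) \<le> b / a"
    unfolding N_def R_def Q_def .
qed

section \<open>Spectral norm\<close>

text \<open>Boundedness is what makes the real \<open>Sup\<close> a genuine supremum; by
  Cauchy-Schwarz in each row the Frobenius norm is an upper bound.\<close>

lemma bdd_above_spec_norm:
  "bdd_above {sqrt (\<Sum>i<d. (\<Sum>j<d. M i j * v j)\<^sup>2) | v. (\<Sum>j<d. (v j)\<^sup>2) = (1::real)}"
proof (rule bdd_aboveI)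
  fix x assume "x \<in> {sqrt (\<Sum>i<d. (\<Sum>j<d. M i j * v j)\<^sup>2) | v. (\<Sum>j<d. (v j)\<^sup>2) = (1::real)}"
  then obtain v where v: "(\<Sum>j<d. (v j)\<^sup>2) = 1" and x: "x = sqrt (\<Sum>i<d. (\<Sum>j<d. M i j * v j)\<^sup>2)"
    by blast
  have "(\<Sum>j<d. M i j * v j)\<^sup>2 \<le> (\<Sum>j<d. (M i j)\<^sup>2)" for i
    using Cauchy_Schwarz_ineq_sum[of "M i" v "{..<d}"] v by simp
  then show "x \<le> sqrt (\<Sum>i<d. \<Sum>j<d. (M i j)\<^sup>2)"
    unfolding x by (intro real_sqrt_le_mono sum_mono)
qed

lemma spec_norm_upper:
  assumes "(\<Sum>j<d. (v j)\<^sup>2) = 1"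
  shows "sqrt (\<Sum>i<d. (\<Sum>j<d. M i j * v j)\<^sup>2) \<le> spec_norm d M"
  unfolding spec_norm_def using assms by (intro cSup_upper bdd_above_spec_norm) auto

text \<open>A witness that the unit sphere is nonempty, so that the supremum in
  \<open>spec_norm\<close> is over a nonempty set.\<close>

lemma sum_unit_vector_squares:
  fixes d :: nat
  shows "0 < d \<Longrightarrow> (\<Sum>j<d. (if j = 0 then 1 else 0)\<^sup>2) = (1::real)"
  by (simp add: if_distrib[of "\<lambda>x. x\<^sup>2"] cong: if_cong)

lemma spec_norm_nonneg:
  assumes "0 < d"
  shows "0 \<le> spec_norm d M"
  using spec_norm_upper[OF sum_unit_vector_squares[OF assms], of M]
  by (meson order_trans real_sqrt_ge_zero sum_nonneg zero_le_power2)

text \<open>Homogeneity: a nonzero \<open>v\<close> is scaled to the unit sphere.\<close>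

lemma spec_norm_bound:
  assumes "0 < d"
  shows "(\<Sum>i<d. (\<Sum>j<d. M i j * v j)\<^sup>2) \<le> (spec_norm d M)\<^sup>2 * (\<Sum>j<d. (v j)\<^sup>2)"
proof (cases "(\<Sum>j<d. (v j)\<^sup>2) = 0")
  case True
  then have "\<And>j. j < d \<Longrightarrow> v j = 0"
    by (simp add: sum_nonneg_eq_0_iff)
  then show ?thesis using True by simp
next
  case False
  define c where "c = sqrt (\<Sum>j<d. (v j)\<^sup>2)"
  have "0 \<le> (\<Sum>j<d. (v j)\<^sup>2)" by (intro sum_nonneg) simp
  then have c: "c > 0" "c\<^sup>2 = (\<Sum>j<d. (v j)\<^sup>2)"
    using False by (auto simp: c_def less_le)
  have "(\<Sum>j<d. (v j / c)\<^sup>2) = 1"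
    using c False by (simp add: power_divide sum_divide_distrib[symmetric])
  from spec_norm_upper[OF this, of M]
  have "(\<Sum>i<d. (\<Sum>j<d. M i j * (v j / c))\<^sup>2) \<le> (spec_norm d M)\<^sup>2"
    by (rule sqrt_le_D)
  also have "(\<Sum>i<d. (\<Sum>j<d. M i j * (v j / c))\<^sup>2) = (\<Sum>i<d. (\<Sum>j<d. M i j * v j)\<^sup>2) / c\<^sup>2"
    by (simp add: sum_divide_distrib[symmetric] power_divide)
  finally show ?thesis using c(1) by (simp add: pos_divide_le_eq c(2)[symmetric])
qed

text \<open>Cauchy-Schwarz: \<open>v^T M v\<close> is at most \<open>|v| * |M v|\<close>.\<close>

lemma spec_norm_quadratic_form:
  assumes "0 < d"
  shows "(\<Sum>i<d. \<Sum>j<d. M i j * v i * v j) \<le> spec_norm d M * (\<Sum>j<d. (v j)\<^sup>2)"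
proof -
  define V where "V = (\<Sum>j<d. (v j)\<^sup>2)"
  have V: "0 \<le> V" unfolding V_def by (intro sum_nonneg) simp
  have "(\<Sum>i<d. \<Sum>j<d. M i j * v i * v j) = (\<Sum>i<d. v i * (\<Sum>j<d. M i j * v j))"
    by (simp add: sum_distrib_left mult_ac)
  then have "(\<Sum>i<d. \<Sum>j<d. M i j * v i * v j)\<^sup>2 \<le> V * (\<Sum>i<d. (\<Sum>j<d. M i j * v j)\<^sup>2)"
    unfolding V_def by (simp add: Cauchy_Schwarz_ineq_sum)
  also have "\<dots> \<le> V * ((spec_norm d M)\<^sup>2 * V)"
    unfolding V_def by (intro mult_left_mono spec_norm_bound assms sum_nonneg) simp
  also have "\<dots> = (spec_norm d M * V)\<^sup>2"
    by (simp add: power2_eq_square)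
  finally show ?thesis
    unfolding V_def[symmetric] by (rule power2_le_imp_le) (simp add: V spec_norm_nonneg assms)
qed

text \<open>By symmetry \<open>|S v|^2 = v^T S^2 v\<close>, which for a unit vector is at most the
  norm of \<open>S^2\<close>. It brings in the denominator of the stable rank of
  \<open>S^2\<close>.\<close>

lemma spec_norm_square_le:
  assumes "0 < d" and sym: "\<And>i j. i < d \<Longrightarrow> j < d \<Longrightarrow> S i j = S j i"
  shows "(spec_norm d S)\<^sup>2 \<le> spec_norm d (mat_mul d S S)"
proof -
  have "spec_norm d S \<le> sqrt (spec_norm d (mat_mul d S S))"
    unfolding spec_norm_def[of d S]
  proof (rule cSup_least)
    show "{sqrt (\<Sum>i<d. (\<Sum>j<d. S i j * v j)\<^sup>2) | v. (\<Sum>j<d. (v j)\<^sup>2) = 1} \<noteq> {}"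
    proof -
      obtain v :: "nat \<Rightarrow> real" where "(\<Sum>j<d. (v j)\<^sup>2) = 1"
        using sum_unit_vector_squares[OF assms(1)] by (rule that)
      then show ?thesis by auto
    qed
    fix x assume "x \<in> {sqrt (\<Sum>i<d. (\<Sum>j<d. S i j * v j)\<^sup>2) | v. (\<Sum>j<d. (v j)\<^sup>2) = 1}"
    then obtain v where v: "(\<Sum>j<d. (v j)\<^sup>2) = 1" and x: "x = sqrt (\<Sum>i<d. (\<Sum>j<d. S i j * v j)\<^sup>2)"
      by blast
    have "(\<Sum>p<d. S p i * S p j) = mat_mul d S S i j" if "i < d" for i j
      unfolding mat_mul_def using sym[OF _ that] by (intro sum.cong) auto
    then have "(\<Sum>i<d. (\<Sum>j<d. S i j * v j)\<^sup>2) = (\<Sum>i<d. \<Sum>j<d. mat_mul d S S i j * v i * v j)"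
      unfolding sum_bilinear_square by simp
    also have "\<dots> \<le> spec_norm d (mat_mul d S S)"
      using spec_norm_quadratic_form[OF assms(1), of "mat_mul d S S" v] v by simp
    finally show "x \<le> sqrt (spec_norm d (mat_mul d S S))"
      unfolding x by simp
  qed
  then have "(spec_norm d S)\<^sup>2 \<le> (sqrt (spec_norm d (mat_mul d S S)))\<^sup>2"
    by (intro power_mono spec_norm_nonneg assms(1))
  then show ?thesis
    by (simp add: spec_norm_nonneg assms(1))
qed

section \<open>Operator bounds for the factor \<open>A\<close> of the covariance and for
  \<open>A^T A\<close>\<close>

lemma gram_factor_transpose_bound:
  assumes "0 < d" and S: "\<And>i j. i < d \<Longrightarrow> j < d \<Longrightarrow> S i j = (\<Sum>k<d. A i k * A j k)"
  shows "(\<Sum>k<d. (\<Sum>i<d. A i k * y i)\<^sup>2) \<le> spec_norm d S * (\<Sum>i<d. (y i)\<^sup>2)"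
proof -
  have "(\<Sum>k<d. (\<Sum>i<d. A i k * y i)\<^sup>2) = (\<Sum>i<d. \<Sum>j<d. S i j * y i * y j)"
    unfolding sum_bilinear_square by (intro sum.cong refl) (simp add: S)
  also have "\<dots> \<le> spec_norm d S * (\<Sum>i<d. (y i)\<^sup>2)"
    by (rule spec_norm_quadratic_form) fact
  finally show ?thesis .
qed

text \<open>The bound for \<open>A^T\<close>, read off from \<open>A A^T = S\<close>, passes to
  \<open>A\<close> by transposition.\<close>

lemma gram_factor_bound:
  assumes "0 < d" and S: "\<And>i j. i < d \<Longrightarrow> j < d \<Longrightarrow> S i j = (\<Sum>k<d. A i k * A j k)"
  shows "(\<Sum>i<d. (\<Sum>k<d. A i k * v k)\<^sup>2) \<le> spec_norm d S * (\<Sum>k<d. (v k)\<^sup>2)"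
  using spec_norm_nonneg[OF assms(1)] gram_factor_transpose_bound[OF assms]
  by (rule transpose_norm_bound[where W = "\<lambda>k i. A i k"])

text \<open>Applying \<open>A\<close> and then \<open>A^T\<close> multiplies the squared norm by at
  most \<open>spec_norm d S\<close> each time, and the square of that norm is at most the norm of
  \<open>S^2\<close>.\<close>

lemma gram_factor_square_bound:
  assumes "0 < d" and S: "\<And>i j. i < d \<Longrightarrow> j < d \<Longrightarrow> S i j = (\<Sum>k<d. A i k * A j k)"
  shows "(\<Sum>k<d. (\<Sum>l<d. (\<Sum>i<d. A i k * A i l) * v l)\<^sup>2)
    \<le> spec_norm d (mat_mul d S S) * (\<Sum>k<d. (v k)\<^sup>2)"
proof -
  define y where "y i = (\<Sum>l<d. A i l * v l)" for i
  define s where "s = spec_norm d S"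
  have s: "0 \<le> s" unfolding s_def by (rule spec_norm_nonneg) fact
  have V: "0 \<le> (\<Sum>k<d. (v k)\<^sup>2)" by (intro sum_nonneg) simp
  have "(\<Sum>l<d. (\<Sum>i<d. A i k * A i l) * v l) = (\<Sum>i<d. A i k * y i)" for k
    unfolding y_def sum_distrib_left sum_distrib_right
    by (subst sum.swap) (simp add: mult_ac)
  then have "(\<Sum>k<d. (\<Sum>l<d. (\<Sum>i<d. A i k * A i l) * v l)\<^sup>2) \<le> s * (\<Sum>i<d. (y i)\<^sup>2)"
    unfolding s_def using gram_factor_transpose_bound[OF assms] by simp
  also have "\<dots> \<le> s * (s * (\<Sum>k<d. (v k)\<^sup>2))"
    unfolding y_def s_def using gram_factor_bound[OF assms] s[unfolded s_def]
    by (intro mult_left_mono) auto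
  also have "\<dots> = s\<^sup>2 * (\<Sum>k<d. (v k)\<^sup>2)" by (simp add: power2_eq_square)
  also have "\<dots> \<le> spec_norm d (mat_mul d S S) * (\<Sum>k<d. (v k)\<^sup>2)"
    unfolding s_def using assms V
    by (intro mult_right_mono spec_norm_square_le) (auto simp: mult.commute)
  finally show ?thesis .
qed

section \<open>Gaussian samples\<close>

text \<open>Bookkeeping for matrices that act on a single row \<open>j\<close> of the Gaussian array
  and vanish on the other coordinates.\<close>

lemma sum_row:
  fixes f :: "nat \<times> nat \<Rightarrow> real"
  assumes "finite R" "j \<in> R"
  shows "(\<Sum>x\<in>R \<times> {..<d}. if fst x = j then f x else 0) = (\<Sum>k<d. f (j, k))"
proof -
  have "(\<Sum>x\<in>R \<times> {..<d}. if fst x = j then f x else 0)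
      = (\<Sum>i\<in>R. \<Sum>k<d. if i = j then f (i, k) else 0)"
    by (simp add: sum.cartesian_product')
  also have "\<dots> = (\<Sum>i\<in>R. if i = j then (\<Sum>k<d. f (i, k)) else 0)"
    by (intro sum.cong) auto
  finally show ?thesis using assms by simp
qed

lemma sum_row_mult:
  fixes v :: "nat \<times> nat \<Rightarrow> real" and m :: "nat \<Rightarrow> real"
  assumes "finite R" "j \<in> R"
  shows "(\<Sum>x\<in>R \<times> {..<d}. (if fst x = j then m (snd x) else 0) * v x) = (\<Sum>k<d. m k * v (j, k))"
  using sum_row[OF assms, of "\<lambda>x. m (snd x) * v x" d]
  by (simp add: if_distribR if_distrib[of "\<lambda>c. c * _"] cong: if_cong)

lemma sum_row_square:
  fixes m :: "nat \<Rightarrow> real" and j :: nat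
  assumes "finite R" "j \<in> R"
  shows "(\<Sum>x\<in>R \<times> {..<d}. (if fst x = j then m (snd x) else 0)\<^sup>2) = (\<Sum>k<d. (m k)\<^sup>2)"
  using sum_row_mult[OF assms, of m "\<lambda>x. if fst x = j then m (snd x) else 0" d]
  by (simp add: power2_eq_square)

text \<open>Extending \<open>M\<close> by zero to all \<open>n * d\<close> coordinates changes
  neither \<open>T\<close> nor the bound \<open>\<beta>\<close>, since the norm of row
  \<open>i\<close> is at most that of the whole array.\<close>

lemma gauss_row_image_norm_tail:
  fixes M :: "'p \<Rightarrow> nat \<Rightarrow> real"
  assumes "i < n" "0 < \<beta>" "0 < \<epsilon>" "\<epsilon> < 1"
    and M: "\<And>v. (\<Sum>p\<in>P. (\<Sum>k<d. M p k * v k)\<^sup>2) \<le> \<beta> * (\<Sum>k<d. (v k)\<^sup>2)"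
  defines "T \<equiv> \<Sum>p\<in>P. \<Sum>k<d. (M p k)\<^sup>2"
  shows "emeasure (std_gauss_space n d) {z \<in> space (std_gauss_space n d).
      \<epsilon> * T < \<bar>(\<Sum>p\<in>P. (\<Sum>k<d. M p k * z (i, k))\<^sup>2) - T\<bar>}
    \<le> ennreal (2 * exp (- (\<epsilon>\<^sup>2 * T / (16 * \<beta>))))"
proof -
  define W where "W p x = (if fst x = i then M p (snd x) else 0)" for p and x :: "nat \<times> nat"
  have W: "(\<Sum>x\<in>{..<n} \<times> {..<d}. W p x * v x) = (\<Sum>k<d. M p k * v (i, k))" for p v
    unfolding W_def using assms(1) by (intro sum_row_mult) auto
  have T: "(\<Sum>x\<in>{..<n} \<times> {..<d}. (W p x)\<^sup>2) = (\<Sum>k<d. (M p k)\<^sup>2)" for p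
    unfolding W_def using assms(1) by (intro sum_row_square) auto
  have "(\<Sum>p\<in>P. (\<Sum>x\<in>{..<n} \<times> {..<d}. W p x * v x)\<^sup>2) \<le> \<beta> * (\<Sum>x\<in>{..<n} \<times> {..<d}. (v x)\<^sup>2)" for v
  proof -
    have "(\<Sum>k<d. (v (i, k))\<^sup>2) = (\<Sum>x\<in>{i} \<times> {..<d}. (v x)\<^sup>2)"
      by (simp add: sum.cartesian_product')
    also have "\<dots> \<le> (\<Sum>x\<in>{..<n} \<times> {..<d}. (v x)\<^sup>2)"
      using assms(1) by (intro sum_mono2) auto
    finally show ?thesis
      unfolding W using M[of "\<lambda>k. v (i, k)"] assms(2)
      by (meson less_imp_le mult_left_mono order_trans)
  qed
  from gauss_image_norm_tail[OF _ assms(2-4) this] show ?thesis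
    unfolding W T T_def std_gauss_space_def by simp
qed

text \<open>Conditioning on row \<open>i\<close> freezes \<open>u\<close>, so that the sum over the other rows is the squared norm
  of the image of a Gaussian vector under a fixed matrix.\<close>
lemma gauss_cross_rows_tail:
  fixes M :: "nat \<Rightarrow> nat \<Rightarrow> real" and d n :: nat
  assumes "i < n" "0 < \<epsilon>" "\<epsilon> < 1"
  defines "u \<equiv> \<lambda>(z :: nat \<times> nat \<Rightarrow> real) k. \<Sum>l<d. M k l * z (i, l)"
  defines "U \<equiv> \<lambda>z. \<Sum>k<d. (u z k)\<^sup>2"
  shows "emeasure (std_gauss_space n d) {z \<in> space (std_gauss_space n d).
      \<epsilon> * (real (n - 1) * U z) < \<bar>(\<Sum>j\<in>{..<n} - {i}. (\<Sum>k<d. u z k * z (j, k))\<^sup>2) - real (n - 1) * U z\<bar>}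
    \<le> ennreal (2 * exp (- (\<epsilon>\<^sup>2 * real (n - 1) / 16)))"
proof -
  define R where "R = {..<n} - {i}"
  define I where "I = {i} \<times> {..<d}"
  define K where "K = R \<times> {..<d}"
  define bad where "bad z y \<longleftrightarrow> \<epsilon> * (real (n - 1) * U z)
    < \<bar>(\<Sum>j\<in>R. (\<Sum>k<d. u z k * y (j, k))\<^sup>2) - real (n - 1) * U z\<bar>" for z y :: "nat \<times> nat \<Rightarrow> real"
  define p where "p = ennreal (2 * exp (- (\<epsilon>\<^sup>2 * real (n - 1) / 16)))"
  have fin: "finite R" "finite I" "finite K" "I \<inter> K = {}"
    by (auto simp: R_def I_def K_def)
  have cardR: "card R = n - 1" using assms(1) by (simp add: R_def)
  have IK: "{..<n} \<times> {..<d} = I \<union> K"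
    using assms(1) by (auto simp: I_def K_def R_def)
  have [measurable]: "(\<lambda>z. z (i, l)) \<in> borel_measurable (gauss (I \<union> K))" if "l < d" for l
    using that by (intro measurable_component_singleton[THEN measurable_compose]) (auto simp: I_def)
  have u_meas[measurable]: "(\<lambda>z. u z k) \<in> borel_measurable (gauss (I \<union> K))" for k
    unfolding u_def by (intro borel_measurable_sum borel_measurable_times) auto
  have z_meas: "(\<lambda>z. z (j, k)) \<in> borel_measurable (gauss (I \<union> K))" if "j \<in> R" "k < d" for j k
    using that by (intro measurable_component_singleton[THEN measurable_compose]) (auto simp: K_def)
  have [measurable]: "U \<in> borel_measurable (gauss (I \<union> K))"
    unfolding U_def by measurable
  have [measurable]: "(\<lambda>z. \<Sum>j\<in>R. (\<Sum>k<d. u z k * z (j, k))\<^sup>2) \<in> borel_measurable (gauss (I \<union> K))"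
    by (intro borel_measurable_sum borel_measurable_power borel_measurable_times u_meas z_meas) auto
  have bad_sets: "{z \<in> space (gauss (I \<union> K)). bad z z} \<in> sets (gauss (I \<union> K))"
    unfolding bad_def by measurable
  have inner: "emeasure (gauss K) {y \<in> space (gauss K). bad x y} \<le> p" for x
  proof (cases "U x = 0")
    \<comment> \<open>With \<open>u x = 0\<close> both sides of the strict inequality in
      \<open>bad\<close> vanish, so the event is empty; the tail bound itself needs
      \<open>U x\<close> positive.\<close>
    case True
    then have "u x k = 0" if "k < d" for k
      using that by (simp add: U_def sum_nonneg_eq_0_iff)
    then have "\<not> bad x y" for y
      by (simp add: bad_def True)
    then show ?thesis by simp
  next
    case False
    moreover have "0 \<le> U x" unfolding U_def by (intro sum_nonneg) simp
    ultimately have U: "0 < U x" by simp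
    define W where "W j x' = (if fst x' = j then u x (snd x') else 0)" for j :: nat and x' :: "nat \<times> nat"
    have W: "(\<Sum>x'\<in>K. W j x' * v x') = (\<Sum>k<d. u x k * v (j, k))" if "j \<in> R" for j v
      unfolding W_def K_def using that fin by (intro sum_row_mult) auto
    have T: "(\<Sum>x'\<in>K. (W j x')\<^sup>2) = U x" if "j \<in> R" for j
      unfolding W_def K_def U_def using that fin by (intro sum_row_square) auto
    have "(\<Sum>j\<in>R. (\<Sum>x'\<in>K. W j x' * v x')\<^sup>2) \<le> U x * (\<Sum>x'\<in>K. (v x')\<^sup>2)" for v
    proof -
      have "(\<Sum>j\<in>R. (\<Sum>x'\<in>K. W j x' * v x')\<^sup>2) = (\<Sum>j\<in>R. (\<Sum>k<d. u x k * v (j, k))\<^sup>2)"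
        by (simp add: W)
      also have "\<dots> \<le> (\<Sum>j\<in>R. U x * (\<Sum>k<d. (v (j, k))\<^sup>2))"
        unfolding U_def by (rule sum_mono) (rule Cauchy_Schwarz_ineq_sum)
      also have "\<dots> = U x * (\<Sum>x'\<in>K. (v x')\<^sup>2)"
        unfolding K_def by (simp add: sum_distrib_left sum.cartesian_product')
      finally show ?thesis .
    qed
    from gauss_image_norm_tail[OF fin(3) U assms(2,3) this]
    show ?thesis
      using U by (simp add: W T bad_def p_def cardR)
  qed
  have "emeasure (gauss (I \<union> K)) {z \<in> space (gauss (I \<union> K)). bad z z}
      = (\<integral>\<^sup>+z. indicator {z \<in> space (gauss (I \<union> K)). bad z z} z \<partial>gauss (I \<union> K))"
    using bad_sets by simp
  \<comment> \<open>Fubini for the product over row \<open>i\<close> and the remaining rows; the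
    bound on the inner integral is uniform in row \<open>i\<close>.\<close>
  also have "\<dots> = (\<integral>\<^sup>+x. \<integral>\<^sup>+y. indicator {z \<in> space (gauss (I \<union> K)). bad z z} (merge I K (x, y))
      \<partial>gauss K \<partial>gauss I)"
    using fin bad_sets by (intro product_sigma_finite.product_nn_integral_fold[OF product_sigma_finite_gauss]) auto
  also have "\<dots> \<le> (\<integral>\<^sup>+x. p \<partial>gauss I)"
  proof (rule nn_integral_mono)
    fix x assume "x \<in> space (gauss I)"
    \<comment> \<open>\<open>u\<close> and \<open>U\<close> depend on row \<open>i\<close> only, and
      the summed rows \<open>j\<close> lie in \<open>K\<close>, so each argument of
      \<open>bad\<close> sees only its own part of the merged point.\<close>
    have m: "bad (merge I K (x, y)) (merge I K (x, y)) \<longleftrightarrow> bad x y" for y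
    proof -
      have 1: "u (merge I K (x, y)) = u x"
        unfolding u_def by (intro ext sum.cong refl) (simp add: merge_def I_def)
      have 2: "merge I K (x, y) (j, k) = y (j, k)" if "j \<in> R" "k < d" for j k
        using that by (auto simp: merge_def I_def K_def R_def)
      have "U (merge I K (x, y)) = U x" by (simp add: U_def 1)
      then show ?thesis by (simp add: bad_def 1 2)
    qed
    have [measurable]: "(\<lambda>y. y (j, k)) \<in> borel_measurable (gauss K)" if "j \<in> R" "k < d" for j k
      using that by (intro measurable_component_singleton[THEN measurable_compose]) (auto simp: K_def)
    have [measurable]: "(\<lambda>y. \<Sum>j\<in>R. (\<Sum>k<d. u x k * y (j, k))\<^sup>2) \<in> borel_measurable (gauss K)"
      by (intro borel_measurable_sum borel_measurable_power borel_measurable_times) auto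
    have s: "{y \<in> space (gauss K). bad x y} \<in> sets (gauss K)"
      unfolding bad_def by measurable
    have "(\<integral>\<^sup>+y. indicator {z \<in> space (gauss (I \<union> K)). bad z z} (merge I K (x, y)) \<partial>gauss K)
        \<le> (\<integral>\<^sup>+y. indicator {y \<in> space (gauss K). bad x y} y \<partial>gauss K)"
      by (intro nn_integral_mono) (auto simp: indicator_def m)
    also have "\<dots> \<le> p" using inner s by simp
    finally show "(\<integral>\<^sup>+y. indicator {z \<in> space (gauss (I \<union> K)). bad z z} (merge I K (x, y)) \<partial>gauss K) \<le> p" .
  qed
  also have "\<dots> = p"
    using prob_space.emeasure_space_1[OF prob_space_gauss[of I]] by simp
  finally show ?thesis
    unfolding std_gauss_space_def IK p_def bad_def R_def .
qed

text \<open>With \<open>u = A\<^sup>T x\<^sub>i\<close> one has \<open>x\<^sub>i\<^sup>T x\<^sub>l = u\<^sup>T z\<^sub>l\<close>.\<close>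
lemma inner_d_gauss_samples:
  "inner_d d (gauss_samples d A z i) (gauss_samples d A z l)
    = (\<Sum>k<d. (\<Sum>m<d. (\<Sum>j<d. A j k * A j m) * z (i, m)) * z (l, k))"
proof -
  define x where "x j = gauss_samples d A z i j" for j
  have u: "(\<Sum>m<d. (\<Sum>j<d. A j k * A j m) * z (i, m)) = (\<Sum>j<d. x j * A j k)" for k
    unfolding x_def gauss_samples_def sum_distrib_left sum_distrib_right
    by (subst sum.swap) (simp add: mult_ac)
  have "inner_d d x (gauss_samples d A z l) = (\<Sum>j<d. \<Sum>k<d. x j * A j k * z (l, k))"
    by (simp add: inner_d_def gauss_samples_def sum_distrib_left mult_ac)
  also have "\<dots> = (\<Sum>k<d. (\<Sum>j<d. x j * A j k) * z (l, k))"
    unfolding sum_distrib_right by (rule sum.swap)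
  finally show ?thesis unfolding u x_def .
qed

section \<open>Simultaneous concentration for all samples\<close>

lemma abs_diff_le_imp_interval:
  fixes a t e :: real
  assumes "\<bar>a - t\<bar> \<le> e * t"
  shows "(1 - e) * t \<le> a" "a \<le> (1 + e) * t"
  using assms by (auto simp: abs_le_iff left_diff_distrib distrib_right)

text \<open>Since 64/16 = 4, the exponential is at most \<open>(\<delta> / n)^4\<close>. One factor
  is kept; the other three give at most 1/8 because \<open>n \<ge> 2\<close> and
  \<open>\<delta> < 1\<close>, and 2/8 is below 1/3. The target is the share of one event in a union
  bound over three events for each of \<open>n\<close> rows.\<close>

lemma exp_tail_le:
  fixes n :: nat
  assumes "2 \<le> n" "0 < \<delta>" "\<delta> < 1" "0 < \<epsilon>" and X: "64 * ln (real n / \<delta>) / \<epsilon>\<^sup>2 \<le> X"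
  shows "2 * exp (- (\<epsilon>\<^sup>2 * X / 16)) \<le> \<delta> / (3 * n)"
proof -
  define L where "L = ln (real n / \<delta>)"
  have "64 * L \<le> X * \<epsilon>\<^sup>2" using X assms(4) unfolding L_def by (simp add: pos_divide_le_eq)
  then have "exp (- (\<epsilon>\<^sup>2 * X / 16)) \<le> exp (4 * (- L))"
    by (simp add: mult.commute)
  also have "\<dots> = exp (- L) ^ 4"
    using exp_of_nat_mult[of 4 "- L"] by simp
  also have "exp (- L) = \<delta> / n"
    unfolding L_def using assms by (simp add: exp_minus)
  also have "(\<delta> / n) ^ 4 = \<delta> / n * (\<delta> / n) ^ 3" by (simp add: eval_nat_numeral)
  also have "\<dots> \<le> \<delta> / n * (1 / 2) ^ 3"
    using assms by (intro mult_left_mono power_mono) (auto simp: divide_simps)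
  finally show ?thesis using assms by (simp add: divide_simps)
qed

text \<open>A union bound over \<open>3 * n\<close> bad events. In the three tail bounds the ratio
  of mean to squared operator norm is bounded below by the stable rank of \<open>S\<close>, that of
  \<open>S^2\<close>, and \<open>n - 1\<close>; the hypotheses make each large enough.\<close>

lemma gauss_samples_concentration:
  fixes A S :: "nat \<Rightarrow> nat \<Rightarrow> real" and d n :: nat
  assumes S: "\<And>i j. i < d \<Longrightarrow> j < d \<Longrightarrow> S i j = (\<Sum>k<d. A i k * A j k)"
    and d: "0 < d" and n: "2 \<le> n" and \<epsilon>: "0 < \<epsilon>" "\<epsilon> < 1" and \<delta>: "0 < \<delta>" "\<delta> < 1"
    and size: "64 * ln (real n / \<delta>) / \<epsilon>\<^sup>2 \<le> real (n - 1)"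
    and deff: "64 * ln (real n / \<delta>) / \<epsilon>\<^sup>2 \<le> d_eff d S"
  defines "M \<equiv> \<lambda>k l. \<Sum>j<d. A j k * A j l"
  defines "u \<equiv> \<lambda>(z :: nat \<times> nat \<Rightarrow> real) i k. \<Sum>l<d. M k l * z (i, l)"
  shows "\<exists>E \<in> sets (std_gauss_space n d). 1 - \<delta> \<le> measure (std_gauss_space n d) E \<and>
    0 < mtrace d S \<and> 0 < mtrace d (mat_mul d S S) \<and>
    (\<forall>z\<in>E. \<forall>i<n.
      \<bar>(\<Sum>p<d. (\<Sum>k<d. A p k * z (i, k))\<^sup>2) - mtrace d S\<bar> \<le> \<epsilon> * mtrace d S \<and>
      \<bar>(\<Sum>k<d. (u z i k)\<^sup>2) - mtrace d (mat_mul d S S)\<bar> \<le> \<epsilon> * mtrace d (mat_mul d S S) \<and>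
      \<bar>(\<Sum>j\<in>{..<n} - {i}. (\<Sum>k<d. u z i k * z (j, k))\<^sup>2) - real (n - 1) * (\<Sum>k<d. (u z i k)\<^sup>2)\<bar>
        \<le> \<epsilon> * (real (n - 1) * (\<Sum>k<d. (u z i k)\<^sup>2)))"
proof -
  define G where "G = std_gauss_space n d"
  have G: "prob_space G"
    unfolding G_def std_gauss_space_def by (rule prob_space_gauss)
  define T1 where "T1 = mtrace d S"
  define T2 where "T2 = mtrace d (mat_mul d S S)"
  define s1 where "s1 = spec_norm d S"
  define s2 where "s2 = spec_norm d (mat_mul d S S)"
  define e where "e = \<delta> / (3 * real n)"
  have "0 < ln (real n / \<delta>)"
    using n \<delta> by (intro ln_gt_zero) (simp add: divide_simps)
  then have "0 < 64 * ln (real n / \<delta>) / \<epsilon>\<^sup>2" using \<epsilon> by simp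
  moreover have srk: "64 * ln (real n / \<delta>) / \<epsilon>\<^sup>2 \<le> T1 / s1" "64 * ln (real n / \<delta>) / \<epsilon>\<^sup>2 \<le> T2 / s2"
    using deff by (auto simp: d_eff_def srk_def T1_def T2_def s1_def s2_def)
  ultimately have "0 < T1 / s1" "0 < T2 / s2" by linarith+
  moreover have "0 \<le> s1" "0 \<le> s2"
    unfolding s1_def s2_def using d by (auto intro: spec_norm_nonneg)
  \<comment> \<open>The quotients are positive and division by zero yields 0, so the nonnegative
    norms are positive, and with them the traces.\<close>
  ultimately have pos: "0 < T1" "0 < s1" "0 < T2" "0 < s2"
    by (auto simp: zero_less_divide_iff)
  have T1: "(\<Sum>p<d. \<Sum>k<d. (A p k)\<^sup>2) = T1"
    by (simp add: T1_def mtrace_def S power2_eq_square)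
  \<comment> \<open>The Frobenius norm of \<open>A^T A\<close> equals that of
    \<open>A A^T = S\<close>, whose square is the trace of \<open>S^2\<close>.\<close>
  have T2: "(\<Sum>k<d. \<Sum>l<d. (M k l)\<^sup>2) = T2"
    unfolding M_def T2_def mtrace_def mat_mul_def
    by (subst sum_gram_squares_swap, intro sum.cong refl) (simp add: S power2_eq_square mult.commute)
  have A_bound: "(\<Sum>p<d. (\<Sum>k<d. A p k * v k)\<^sup>2) \<le> s1 * (\<Sum>k<d. (v k)\<^sup>2)" for v
    unfolding s1_def using d S by (rule gram_factor_bound)
  have M_bound: "(\<Sum>k<d. (\<Sum>l<d. M k l * v l)\<^sup>2) \<le> s2 * (\<Sum>k<d. (v k)\<^sup>2)" for v
    unfolding s2_def M_def using d S by (rule gram_factor_square_bound)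
  define bad1 where "bad1 i = {z \<in> space G.
    \<epsilon> * T1 < \<bar>(\<Sum>p<d. (\<Sum>k<d. A p k * z (i, k))\<^sup>2) - T1\<bar>}" for i
  define bad2 where "bad2 i = {z \<in> space G. \<epsilon> * T2 < \<bar>(\<Sum>k<d. (u z i k)\<^sup>2) - T2\<bar>}" for i
  define bad3 where "bad3 i = {z \<in> space G. \<epsilon> * (real (n - 1) * (\<Sum>k<d. (u z i k)\<^sup>2))
    < \<bar>(\<Sum>j\<in>{..<n} - {i}. (\<Sum>k<d. u z i k * z (j, k))\<^sup>2) - real (n - 1) * (\<Sum>k<d. (u z i k)\<^sup>2)\<bar>}" for i
  define bad where "bad i = bad1 i \<union> bad2 i \<union> bad3 i" for i
  have z_meas: "(\<lambda>z. z (i, k)) \<in> borel_measurable G" if "i < n" "k < d" for i k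
    unfolding G_def std_gauss_space_def using that
    by (intro measurable_component_singleton[THEN measurable_compose]) auto
  have u_meas: "(\<lambda>z. u z i k) \<in> borel_measurable G" if "i < n" for i k
    unfolding u_def using that by (intro borel_measurable_sum borel_measurable_times z_meas) auto
  have bad_sets: "bad1 i \<in> sets G" "bad2 i \<in> sets G" "bad3 i \<in> sets G" if i: "i < n" for i
  proof -
    have [measurable]: "(\<lambda>z. \<Sum>p<d. (\<Sum>k<d. A p k * z (i, k))\<^sup>2) \<in> borel_measurable G"
      using i by (intro borel_measurable_sum borel_measurable_power borel_measurable_times z_meas) auto
    have [measurable]: "(\<lambda>z. \<Sum>k<d. (u z i k)\<^sup>2) \<in> borel_measurable G"
      using i by (intro borel_measurable_sum borel_measurable_power u_meas)
    have [measurable]: "(\<lambda>z. \<Sum>j\<in>{..<n} - {i}. (\<Sum>k<d. u z i k * z (j, k))\<^sup>2) \<in> borel_measurable G"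
      using i by (intro borel_measurable_sum borel_measurable_power borel_measurable_times u_meas z_meas) auto
    show "bad1 i \<in> sets G" "bad2 i \<in> sets G" "bad3 i \<in> sets G"
      unfolding bad1_def bad2_def bad3_def by measurable
  qed
  \<comment> \<open>\<open>X\<close> stands in turn for \<open>T1 / s1\<close>,
    \<open>T2 / s2\<close> and \<open>n - 1\<close>.\<close>
  have prob_le: "measure G B \<le> e"
    if "emeasure G B \<le> ennreal (2 * exp (- (\<epsilon>\<^sup>2 * X / 16)))" "64 * ln (real n / \<delta>) / \<epsilon>\<^sup>2 \<le> X" for B X
    using that exp_tail_le[OF n \<delta> \<epsilon>(1) that(2)]
    by (simp add: finite_measure.emeasure_eq_measure[OF prob_space.finite_measure[OF G]] e_def)
  have bad_prob: "measure G (bad i) \<le> 3 * e" if i: "i < n" for i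
  proof -
    have "emeasure G (bad1 i) \<le> ennreal (2 * exp (- (\<epsilon>\<^sup>2 * (T1 / s1) / 16)))"
      using gauss_row_image_norm_tail[OF i pos(2) \<epsilon> A_bound]
      by (simp add: T1 G_def bad1_def mult.commute)
    then have 1: "measure G (bad1 i) \<le> e" using srk(1) by (rule prob_le)
    have "emeasure G (bad2 i) \<le> ennreal (2 * exp (- (\<epsilon>\<^sup>2 * (T2 / s2) / 16)))"
      using gauss_row_image_norm_tail[OF i pos(4) \<epsilon> M_bound]
      by (simp add: T2 G_def bad2_def u_def mult.commute)
    then have 2: "measure G (bad2 i) \<le> e" using srk(2) by (rule prob_le)
    have "emeasure G (bad3 i) \<le> ennreal (2 * exp (- (\<epsilon>\<^sup>2 * real (n - 1) / 16)))"
      unfolding G_def bad3_def u_def by (rule gauss_cross_rows_tail[OF i \<epsilon>])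
    then have 3: "measure G (bad3 i) \<le> e" using size by (rule prob_le)
    have "measure G (bad i) \<le> measure G (bad1 i \<union> bad2 i) + measure G (bad3 i)"
      unfolding bad_def using bad_sets[OF i] by (intro measure_Un_le) auto
    also have "measure G (bad1 i \<union> bad2 i) \<le> measure G (bad1 i) + measure G (bad2 i)"
      using bad_sets[OF i] by (intro measure_Un_le) auto
    finally show ?thesis using 1 2 3 by linarith
  qed
  define E where "E = space G - (\<Union>i<n. bad i)"
  have events: "(\<Union>i<n. bad i) \<in> sets G" "bad ` {..<n} \<subseteq> sets G"
    using bad_sets by (auto simp: bad_def)
  have "measure G (\<Union>i<n. bad i) \<le> (\<Sum>i<n. measure G (bad i))"
    using events by (intro measure_UNION_le) auto
  also have "\<dots> \<le> (\<Sum>i<n. 3 * e)"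
    by (intro sum_mono bad_prob) simp
  also have "\<dots> = \<delta>" using n by (simp add: e_def)
  finally have "1 - \<delta> \<le> measure G E"
    unfolding E_def using events(1) by (simp add: prob_space.prob_compl[OF G])
  moreover have "E \<in> sets G"
    unfolding E_def using events by auto
  moreover have "\<bar>(\<Sum>p<d. (\<Sum>k<d. A p k * z (i, k))\<^sup>2) - T1\<bar> \<le> \<epsilon> * T1 \<and>
      \<bar>(\<Sum>k<d. (u z i k)\<^sup>2) - T2\<bar> \<le> \<epsilon> * T2 \<and>
      \<bar>(\<Sum>j\<in>{..<n} - {i}. (\<Sum>k<d. u z i k * z (j, k))\<^sup>2) - real (n - 1) * (\<Sum>k<d. (u z i k)\<^sup>2)\<bar>
        \<le> \<epsilon> * (real (n - 1) * (\<Sum>k<d. (u z i k)\<^sup>2))" if "z \<in> E" "i < n" for z i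
  proof -
    have "z \<in> space G" "z \<notin> bad1 i" "z \<notin> bad2 i" "z \<notin> bad3 i"
      using that by (auto simp: E_def bad_def)
    then show ?thesis by (auto simp: bad1_def bad2_def bad3_def not_less)
  qed
  ultimately show ?thesis
    using pos unfolding G_def T1_def T2_def by blast
qed

text \<open>With \<open>K = (tr S)\<^sup>2 + (n - 1) tr S\<^sup>2\<close>, each \<open>\<Sum>\<^sub>l (x\<^sub>i\<^sup>T x\<^sub>l)\<^sup>2\<close> lies in
  \<open>[(1 - \<epsilon>)\<^sup>2 K, (1 + \<epsilon>)\<^sup>2 K]\<close>; the diagonal term is \<open>\<parallel>x\<^sub>i\<parallel>\<^sup>4\<close>.\<close>
theorem mainTheorem2:
  shows "\<exists>C>0. \<forall>(d::nat) (n::nat) (S::nat \<Rightarrow> nat \<Rightarrow> real) (A::nat \<Rightarrow> nat \<Rightarrow> real) (\<epsilon>::real) (\<delta>::real).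
    sym_psd d S \<and> (\<exists>i<d. \<exists>j<d. S i j \<noteq> 0) \<and>
    (\<forall>i<d. \<forall>j<d. S i j = (\<Sum>k<d. A i k * A j k)) \<and>
    2 \<le> n \<and> 0 < \<epsilon> \<and> \<epsilon> < 1 \<and> 0 < \<delta> \<and> \<delta> < 1 \<and>
    real n / ln (real n / \<delta>) \<ge> C / \<epsilon>\<^sup>2 \<and>
    d_eff d S \<ge> C * ln (real n / \<delta>) / \<epsilon>\<^sup>2
    \<longrightarrow> (\<exists>E \<in> sets (std_gauss_space n d).
          measure (std_gauss_space n d) E \<ge> 1 - \<delta> \<and>
          (\<forall>z\<in>E. \<forall>(y::nat \<Rightarrow> real) (w::nat \<Rightarrow> real).
             (1 - \<epsilon>)\<^sup>2 / (1 + \<epsilon>)\<^sup>2 \<le> mu d n (gauss_samples d A z) y w \<and>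
             mu d n (gauss_samples d A z) y w \<le> (1 + \<epsilon>)\<^sup>2 / (1 - \<epsilon>)\<^sup>2))"
proof (rule exI[of _ "128 :: real"], intro conjI allI impI)
  show "(0 :: real) < 128" by simp
next
  fix d n :: nat and S A :: "nat \<Rightarrow> nat \<Rightarrow> real" and \<epsilon> \<delta> :: real
  assume asm: "sym_psd d S \<and> (\<exists>i<d. \<exists>j<d. S i j \<noteq> 0) \<and>
    (\<forall>i<d. \<forall>j<d. S i j = (\<Sum>k<d. A i k * A j k)) \<and>
    2 \<le> n \<and> 0 < \<epsilon> \<and> \<epsilon> < 1 \<and> 0 < \<delta> \<and> \<delta> < 1 \<and>
    real n / ln (real n / \<delta>) \<ge> 128 / \<epsilon>\<^sup>2 \<and>
    d_eff d S \<ge> 128 * ln (real n / \<delta>) / \<epsilon>\<^sup>2"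
  then have d: "0 < d" and n: "2 \<le> n" and \<epsilon>: "0 < \<epsilon>" "\<epsilon> < 1" and \<delta>: "0 < \<delta>" "\<delta> < 1" by auto
  have S: "\<And>i j. i < d \<Longrightarrow> j < d \<Longrightarrow> S i j = (\<Sum>k<d. A i k * A j k)" using asm by blast
  define L where "L = ln (real n / \<delta>)"
  have L: "0 < L" unfolding L_def using n \<delta> by (intro ln_gt_zero) (simp add: divide_simps)
  have "128 / \<epsilon>\<^sup>2 \<le> real n / L" and deff: "128 * L / \<epsilon>\<^sup>2 \<le> d_eff d S"
    using asm by (auto simp: L_def)
  then have "128 * L / \<epsilon>\<^sup>2 \<le> real n" using L by (simp add: pos_le_divide_eq)
  \<comment> \<open>The cross terms involve only \<open>n - 1\<close> rows; \<open>n \<ge> 2\<close>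
    costs a factor 2, which is why 128 is taken as twice the 64 of the concentration lemma.\<close>
  moreover have "real n \<le> 2 * real (n - 1)" using n by simp
  ultimately have size: "64 * ln (real n / \<delta>) / \<epsilon>\<^sup>2 \<le> real (n - 1)"
    unfolding L_def by simp
  have "0 < L / \<epsilon>\<^sup>2" using L \<epsilon> by simp
  then have deff: "64 * ln (real n / \<delta>) / \<epsilon>\<^sup>2 \<le> d_eff d S"
    using deff unfolding L_def by simp
  define T1 where "T1 = mtrace d S"
  define T2 where "T2 = mtrace d (mat_mul d S S)"
  define u where "u z i k = (\<Sum>l<d. (\<Sum>j<d. A j k * A j l) * z (i, l))"
    for z :: "nat \<times> nat \<Rightarrow> real" and i k
  define U where "U z i = (\<Sum>k<d. (u z i k)\<^sup>2)" for z i
  define m where "m = real (n - 1)"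
  obtain E where E: "E \<in> sets (std_gauss_space n d)" "1 - \<delta> \<le> measure (std_gauss_space n d) E"
    and T: "0 < T1" "0 < T2"
    and conc: "\<And>z i. z \<in> E \<Longrightarrow> i < n \<Longrightarrow> \<bar>(\<Sum>p<d. (\<Sum>k<d. A p k * z (i, k))\<^sup>2) - T1\<bar> \<le> \<epsilon> * T1"
      "\<And>z i. z \<in> E \<Longrightarrow> i < n \<Longrightarrow> \<bar>U z i - T2\<bar> \<le> \<epsilon> * T2"
      "\<And>z i. z \<in> E \<Longrightarrow> i < n \<Longrightarrow>
        \<bar>(\<Sum>j\<in>{..<n} - {i}. (\<Sum>k<d. u z i k * z (j, k))\<^sup>2) - m * U z i\<bar> \<le> \<epsilon> * (m * U z i)"
    using gauss_samples_concentration[OF S d n \<epsilon> \<delta> size deff]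
    unfolding T1_def[symmetric] T2_def[symmetric] u_def[symmetric] U_def[symmetric] m_def[symmetric]
    by blast
  have m: "0 \<le> m" by (simp add: m_def)
  define K where "K = T1\<^sup>2 + m * T2"
  have K: "0 < K" unfolding K_def using T m by (intro add_pos_nonneg) auto
  have \<epsilon>2: "0 < (1 - \<epsilon>)\<^sup>2" "(1 - \<epsilon>)\<^sup>2 \<le> (1 + \<epsilon>)\<^sup>2"
    using \<epsilon> by (auto intro: power_mono)
  show "\<exists>E \<in> sets (std_gauss_space n d).
          measure (std_gauss_space n d) E \<ge> 1 - \<delta> \<and>
          (\<forall>z\<in>E. \<forall>(y::nat \<Rightarrow> real) (w::nat \<Rightarrow> real).
             (1 - \<epsilon>)\<^sup>2 / (1 + \<epsilon>)\<^sup>2 \<le> mu d n (gauss_samples d A z) y w \<and>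
             mu d n (gauss_samples d A z) y w \<le> (1 + \<epsilon>)\<^sup>2 / (1 - \<epsilon>)\<^sup>2)"
  proof (intro bexI[OF _ E(1)] conjI ballI allI E(2))
    \<comment> \<open>\<open>E\<close> was fixed before \<open>y\<close> and \<open>w\<close>: the
      concentration concerns the samples alone, so the bound holds for all targets and weights at
      once.\<close>
    fix z and y w :: "nat \<Rightarrow> real"
    assume z: "z \<in> E"
    define x where "x = gauss_samples d A z"
    have q: "(1 - \<epsilon>)\<^sup>2 * K \<le> (\<Sum>l<n. (inner_d d (x i) (x l))\<^sup>2)"
      "(\<Sum>l<n. (inner_d d (x i) (x l))\<^sup>2) \<le> (1 + \<epsilon>)\<^sup>2 * K" if i: "i < n" for i
    proof -
      define X where "X = (\<Sum>p<d. (\<Sum>k<d. A p k * z (i, k))\<^sup>2)"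
      define Y where "Y = (\<Sum>j\<in>{..<n} - {i}. (\<Sum>k<d. u z i k * z (j, k))\<^sup>2)"
      have "inner_d d (x i) (x i) = X"
        by (simp add: X_def x_def inner_d_def gauss_samples_def power2_eq_square)
      moreover have "inner_d d (x i) (x l) = (\<Sum>k<d. u z i k * z (l, k))" for l
        unfolding x_def inner_d_gauss_samples u_def ..
      ultimately have q: "(\<Sum>l<n. (inner_d d (x i) (x l))\<^sup>2) = X\<^sup>2 + Y"
        using i unfolding Y_def by (subst sum.remove[of _ i]) auto
      have X: "(1 - \<epsilon>) * T1 \<le> X" "X \<le> (1 + \<epsilon>) * T1"
        using abs_diff_le_imp_interval[OF conc(1)[OF z i]] unfolding X_def by auto
      have U: "(1 - \<epsilon>) * T2 \<le> U z i" "U z i \<le> (1 + \<epsilon>) * T2"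
        using abs_diff_le_imp_interval[OF conc(2)[OF z i]] by auto
      have Y: "(1 - \<epsilon>) * (m * U z i) \<le> Y" "Y \<le> (1 + \<epsilon>) * (m * U z i)"
        using abs_diff_le_imp_interval[OF conc(3)[OF z i]] unfolding Y_def by auto
      \<comment> \<open>Both parts lose a factor \<open>(1 - \<epsilon>)\<close> twice: the diagonal
        term by squaring \<open>X\<close>, the cross terms because \<open>Y\<close> is close to
        \<open>m * U z i\<close> and \<open>U z i\<close> is close to \<open>T2\<close>.\<close>
      have "(1 - \<epsilon>)\<^sup>2 * T1\<^sup>2 \<le> X\<^sup>2"
        unfolding power_mult_distrib[symmetric] using X(1) \<epsilon> T by (intro power_mono) auto
      moreover have "(1 - \<epsilon>) * (m * ((1 - \<epsilon>) * T2)) \<le> (1 - \<epsilon>) * (m * U z i)"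
        using U(1) m \<epsilon> by (intro mult_left_mono) auto
      ultimately show "(1 - \<epsilon>)\<^sup>2 * K \<le> (\<Sum>l<n. (inner_d d (x i) (x l))\<^sup>2)"
        unfolding q K_def using Y(1) by (simp add: distrib_left power2_eq_square mult_ac)
      have "0 \<le> X" unfolding X_def by (intro sum_nonneg) simp
      then have "X\<^sup>2 \<le> (1 + \<epsilon>)\<^sup>2 * T1\<^sup>2"
        unfolding power_mult_distrib[symmetric] using X(2) by (intro power_mono) auto
      moreover have "(1 + \<epsilon>) * (m * U z i) \<le> (1 + \<epsilon>) * (m * ((1 + \<epsilon>) * T2))"
        using U(2) m \<epsilon> by (intro mult_left_mono) auto
      ultimately show "(\<Sum>l<n. (inner_d d (x i) (x l))\<^sup>2) \<le> (1 + \<epsilon>)\<^sup>2 * K"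
        unfolding q K_def using Y(2) by (simp add: distrib_left power2_eq_square mult_ac)
    qed
    define r where "r i = inner_d d w (x i) - y i" for i
    define g where "g i = (\<Sum>l<n. (inner_d d (x i) (x l))\<^sup>2)" for i
    have frob: "frob_sq d (gram n x) = (\<Sum>i<n. g i) / (real n)\<^sup>2"
      unfolding frob_sq_def gram_def g_def inner_d_def by (rule frobenius_mean_gram)
    have tr: "mtrace d (mat_mul d (grad_cov d n x y w) (gram n x)) = (\<Sum>i<n. (r i)\<^sup>2 * g i) / (real n)\<^sup>2"
      unfolding mtrace_def mat_mul_def grad_cov_def grad_i_def gram_def g_def r_def[symmetric]
        inner_d_def[of d "x _" "x _"] by (rule trace_weighted_gram_product)
    have loss: "2 * emp_loss d n x y w = (\<Sum>i<n. (r i)\<^sup>2) / n"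
      by (simp add: emp_loss_def loss_i_def r_def sum_divide_distrib[symmetric])
    have mu: "mu d n x y w = n * (\<Sum>i<n. (r i)\<^sup>2 * g i) / ((\<Sum>i<n. (r i)\<^sup>2) * (\<Sum>i<n. g i))"
      if "(\<Sum>i<n. (r i)\<^sup>2) \<noteq> 0" "(\<Sum>i<n. g i) \<noteq> 0"
      using that n unfolding mu_def loss frob tr Let_def by (simp add: field_simps power2_eq_square)
    have mu1: "mu d n x y w = 1" if "(\<Sum>i<n. (r i)\<^sup>2) = 0 \<or> (\<Sum>i<n. g i) = 0"
      using that unfolding mu_def loss frob Let_def by auto
    have "(1 - \<epsilon>)\<^sup>2 / (1 + \<epsilon>)\<^sup>2 \<le> mu d n x y w \<and> mu d n x y w \<le> (1 + \<epsilon>)\<^sup>2 / (1 - \<epsilon>)\<^sup>2"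
    proof (cases "(\<Sum>i<n. (r i)\<^sup>2) = 0 \<or> (\<Sum>i<n. g i) = 0")
      \<comment> \<open>A vanishing denominator gives the default value 1, which lies between the
        two bounds.\<close>
      case True
      have "0 < (1 + \<epsilon>)\<^sup>2" using \<epsilon>2 by linarith
      then show ?thesis
        unfolding mu1[OF True] using \<epsilon>2 by (simp only: divide_le_eq_1_pos le_divide_eq_1_pos)
    next
      case False
      then have nz: "(\<Sum>i<n. (r i)\<^sup>2) \<noteq> 0" "(\<Sum>i<n. g i) \<noteq> 0" by auto
      show ?thesis
        unfolding mu[OF nz] using weighted_mean_over_mean_bounds[OF \<epsilon>2 K _ q[folded g_def] nz(1)] by simp
    qed
    then show "(1 - \<epsilon>)\<^sup>2 / (1 + \<epsilon>)\<^sup>2 \<le> mu d n (gauss_samples d A z) y w"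
      "mu d n (gauss_samples d A z) y w \<le> (1 + \<epsilon>)\<^sup>2 / (1 - \<epsilon>)\<^sup>2"
      unfolding x_def by auto
  qed
qed

end
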